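(* Let $M$ be a smooth manifold, $h$ a non-degenerate $(0,2)$-tensor field on $M$ and $\nabla$ an affine connection on $M$. Let $\hat J_c,\hat J_p$ be the endomorphisms of $TM\oplus T^*M$ given by $\hat J_c(X+\alpha)=-h^{-1}(\alpha)+h(X)$ and $\hat J_p(X+\alpha)=h^{-1}(\alpha)+h(X)$. Then $\hat J_c$ is $\nabla$-integrable if and only if $(M,h,\nabla)$ is a quasi-statistical manifold, and likewise $\hat J_p$ is $\nabla$-integrable if and only if $(M,h,\nabla)$ is a quasi-statistical manifold.
   Context: $C^\infty(E)$ denotes smooth sections of a bundle $E$. An affine connection $\nabla$ on $M$ is a linear connection on $TM$, possibly with torsion $T^\nabla(X,Y)=\nabla_XY-\nabla_YX-[X,Y]$; it acts on 1-forms by $(\nabla_X\beta)(Y)=X(\beta(Y))-\beta(\nabla_XY)$ and on $(0,2)$-tensors in the usual way. The tensor $h$ is not assumed symmetric; $h$ also denotes the isomorphism $TM\to T^*M$, $h(X)=h(X,\cdot)$, with inverse $h^{-1}:T^*M\to TM$. Quasi-statistical: $(M,h,\nabla)$ is a quasi-statistical manifold if $d^\nabla h=0$, where $(d^\nabla h)(X,Y,Z)=(\nabla_Xh)(Y,Z)-(\nabla_Yh)(X,Z)+h(T^\nabla(X,Y),Z)$. Bracket: $[X+\alpha,Y+\beta]_\nabla=[X,Y]+\nabla_X\beta-\nabla_Y\alpha$ on $C^\infty(TM\oplus T^*M)$. $\nabla$-integrability: a bundle endomorphism $\hat J$ of $TM\oplus T^*M$ with $\hat J^2=\pm I$ is $\nabla$-integrable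 if $N^\nabla_{\hat J}(\sigma,\tau)=[\hat J\sigma,\hat J\tau]_\nabla-\hat J[\hat J\sigma,\tau]_\nabla-\hat J[\sigma,\hat J\tau]_\nabla+\hat J^2[\sigma,\tau]_\nabla$ vanishes for all $\sigma,\tau\in C^\infty(TM\oplus T^*M)$. *)

theory Defs
  imports "HOL-Analysis.Analysis" "HOL-Library.Function_Algebras"
begin

section \<open>Smooth maps between Euclidean spaces and smooth manifolds\<close>

(* Only meant for open S, where the (unrestricted) Frechet derivative is the right one. *)
primrec Ck_on ::
  "nat \<Rightarrow> 'e::euclidean_space set \<Rightarrow> ('e \<Rightarrow> 'b::real_normed_vector) \<Rightarrow> bool" where
  "Ck_on 0 S f \<longleftrightarrow> continuous_on S f"
| "Ck_on (Suc k) S f \<longleftrightarrow>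
     f differentiable_on S \<and> (\<forall>v. Ck_on k S (\<lambda>x. frechet_derivative f (at x) v))"

definition smooth_on ::
  "'e::euclidean_space set \<Rightarrow> ('e \<Rightarrow> 'b::real_normed_vector) \<Rightarrow> bool" where
  "smooth_on S f \<longleftrightarrow> (\<forall>k. Ck_on k S f)"

type_synonym ('m, 'e) chart = "'m set \<times> ('m \<Rightarrow> 'e)"

definition is_chart :: "('m::topological_space, 'e::euclidean_space) chart \<Rightarrow> bool" where
  "is_chart = (\<lambda>(U, \<phi>).
     open U \<and> open (\<phi> ` U) \<and> homeomorphism U (\<phi> ` U) \<phi> (inv_into U \<phi>))"

(* The transition map goes from the first chart to the second one. *)
definition compatible ::
  "('m::topological_space, 'e::euclidean_space) chart \<Rightarrow> ('m, 'e) chart \<Rightarrow> bool" where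
  "compatible = (\<lambda>(U, \<phi>) (V, \<psi>). smooth_on (\<phi> ` (U \<inter> V)) (\<psi> \<circ> inv_into U \<phi>))"

(* The manifold M is the whole type 'm, Hausdorff and second countable by its sort,
   with model space 'e; an atlas (not necessarily maximal) gives the smooth structure. *)
definition smooth_atlas ::
  "('m::{t2_space, second_countable_topology}, 'e::euclidean_space) chart set \<Rightarrow> bool" where
  "smooth_atlas A \<longleftrightarrow>
     (\<forall>c\<in>A. is_chart c) \<and> (\<Union>c\<in>A. fst c) = UNIV \<and> (\<forall>c\<in>A. \<forall>d\<in>A. compatible c d)"

definition smooth_functions ::
  "('m::topological_space, 'e::euclidean_space) chart set \<Rightarrow> ('m \<Rightarrow> real) set" where
  "smooth_functions A = {f. \<forall>(U, \<phi>)\<in>A. smooth_on (\<phi> ` U) (f \<circ> inv_into U \<phi>)}"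


section \<open>Tangent and cotangent spaces, sections\<close>

(* Pointwise scalar multiplication; used for functions, tangent vectors and covectors.
   Addition, subtraction and zero are the pointwise ones of Function_Algebras. *)
definition scl :: "real \<Rightarrow> ('x \<Rightarrow> real) \<Rightarrow> 'x \<Rightarrow> real" where
  "scl c u = (\<lambda>x. c * u x)"

type_synonym 'm tvec = "('m \<Rightarrow> real) \<Rightarrow> real"
type_synonym 'm cvec = "'m tvec \<Rightarrow> real"

(* Derivations of the algebra of smooth functions at p. The value on non-smooth functions
   is fixed to be 0, so that equality of tangent vectors is equality in HOL. *)
definition tangent_space ::
  "('m::topological_space, 'e::euclidean_space) chart set \<Rightarrow> 'm \<Rightarrow> 'm tvec set" where
  "tangent_space A p = {v.
     (\<forall>f\<in>smooth_functions A. \<forall>g\<in>smooth_functions A. v (f + g) = v f + v g) \<and>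
     (\<forall>c. \<forall>f\<in>smooth_functions A. v (scl c f) = c * v f) \<and>
     (\<forall>f\<in>smooth_functions A. \<forall>g\<in>smooth_functions A. v (f * g) = f p * v g + g p * v f) \<and>
     (\<forall>f. f \<notin> smooth_functions A \<longrightarrow> v f = 0)}"

(* The dual of the tangent space, extended by 0 off the tangent space. *)
definition cotangent_space ::
  "('m::topological_space, 'e::euclidean_space) chart set \<Rightarrow> 'm \<Rightarrow> 'm cvec set" where
  "cotangent_space A p = {\<xi>.
     (\<forall>v\<in>tangent_space A p. \<forall>w\<in>tangent_space A p. \<xi> (v + w) = \<xi> v + \<xi> w) \<and>
     (\<forall>c. \<forall>v\<in>tangent_space A p. \<xi> (scl c v) = c * \<xi> v) \<and>
     (\<forall>v. v \<notin> tangent_space A p \<longrightarrow> \<xi> v = 0)}"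

definition vector_fields ::
  "('m::topological_space, 'e::euclidean_space) chart set \<Rightarrow> ('m \<Rightarrow> 'm tvec) set" where
  "vector_fields A = {X. (\<forall>p. X p \<in> tangent_space A p) \<and>
     (\<forall>f\<in>smooth_functions A. (\<lambda>p. X p f) \<in> smooth_functions A)}"

definition one_forms ::
  "('m::topological_space, 'e::euclidean_space) chart set \<Rightarrow> ('m \<Rightarrow> 'm cvec) set" where
  "one_forms A = {\<alpha>. (\<forall>p. \<alpha> p \<in> cotangent_space A p) \<and>
     (\<forall>X\<in>vector_fields A. (\<lambda>p. \<alpha> p (X p)) \<in> smooth_functions A)}"

definition tensor_fields02 ::
  "('m::topological_space, 'e::euclidean_space) chart set \<Rightarrow>
     ('m \<Rightarrow> 'm tvec \<Rightarrow> 'm tvec \<Rightarrow> real) set" where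
  "tensor_fields02 A = {h.
     (\<forall>p. (\<forall>v\<in>tangent_space A p. h p v \<in> cotangent_space A p) \<and>
          (\<forall>v\<in>tangent_space A p. \<forall>w\<in>tangent_space A p. h p (v + w) = h p v + h p w) \<and>
          (\<forall>c. \<forall>v\<in>tangent_space A p. h p (scl c v) = scl c (h p v))) \<and>
     (\<forall>X\<in>vector_fields A. \<forall>Y\<in>vector_fields A.
          (\<lambda>p. h p (X p) (Y p)) \<in> smooth_functions A)}"

(* The spaces are finite-dimensional, so the kernel in the first argument suffices. *)
definition nondegenerate ::
  "('m::topological_space, 'e::euclidean_space) chart set \<Rightarrow>
     ('m \<Rightarrow> 'm tvec \<Rightarrow> 'm tvec \<Rightarrow> real) \<Rightarrow> bool" where
  "nondegenerate A h \<longleftrightarrow>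
     (\<forall>p. \<forall>v\<in>tangent_space A p. (\<forall>w\<in>tangent_space A p. h p v w = 0) \<longrightarrow> v = 0)"

definition lie_bracket :: "('m \<Rightarrow> 'm tvec) \<Rightarrow> ('m \<Rightarrow> 'm tvec) \<Rightarrow> 'm \<Rightarrow> 'm tvec" where
  "lie_bracket X Y = (\<lambda>p f. X p (\<lambda>q. Y q f) - Y p (\<lambda>q. X q f))"


section \<open>Affine connections\<close>

type_synonym 'm connection = "('m \<Rightarrow> 'm tvec) \<Rightarrow> ('m \<Rightarrow> 'm tvec) \<Rightarrow> 'm \<Rightarrow> 'm tvec"

definition affine_connection ::
  "('m::topological_space, 'e::euclidean_space) chart set \<Rightarrow> 'm connection \<Rightarrow> bool" where
  "affine_connection A D \<longleftrightarrow>
     (\<forall>X\<in>vector_fields A. \<forall>Y\<in>vector_fields A. D X Y \<in> vector_fields A) \<and>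
     (\<forall>X\<in>vector_fields A. \<forall>X'\<in>vector_fields A. \<forall>Y\<in>vector_fields A.
        D (X + X') Y = D X Y + D X' Y) \<and>
     (\<forall>f\<in>smooth_functions A. \<forall>X\<in>vector_fields A. \<forall>Y\<in>vector_fields A.
        D (\<lambda>p. scl (f p) (X p)) Y = (\<lambda>p. scl (f p) (D X Y p))) \<and>
     (\<forall>X\<in>vector_fields A. \<forall>Y\<in>vector_fields A. \<forall>Y'\<in>vector_fields A.
        D X (Y + Y') = D X Y + D X Y') \<and>
     (\<forall>f\<in>smooth_functions A. \<forall>X\<in>vector_fields A. \<forall>Y\<in>vector_fields A.
        D X (\<lambda>p. scl (f p) (Y p)) = (\<lambda>p. scl (X p f) (Y p) + scl (f p) (D X Y p)))"

definition torsion :: "'m connection \<Rightarrow> ('m \<Rightarrow> 'm tvec) \<Rightarrow> ('m \<Rightarrow> 'm tvec) \<Rightarrow> 'm \<Rightarrow> 'm tvec" where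
  "torsion D X Y = D X Y - D Y X - lie_bracket X Y"

(* The right-hand side of the characterising equation is function-linear in Y, hence comes
   from exactly one smooth 1-form; definite description picks this 1-form. *)
definition cov_form ::
  "('m::topological_space, 'e::euclidean_space) chart set \<Rightarrow> 'm connection \<Rightarrow>
     ('m \<Rightarrow> 'm tvec) \<Rightarrow> ('m \<Rightarrow> 'm cvec) \<Rightarrow> 'm \<Rightarrow> 'm cvec" where
  "cov_form A D X \<beta> = (THE \<gamma>. \<gamma> \<in> one_forms A \<and>
     (\<forall>Y\<in>vector_fields A. \<forall>p. \<gamma> p (Y p) = X p (\<lambda>q. \<beta> q (Y q)) - \<beta> p (D X Y p)))"

definition cov_tensor ::
  "'m connection \<Rightarrow> ('m \<Rightarrow> 'm tvec \<Rightarrow> 'm tvec \<Rightarrow> real) \<Rightarrow>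
     ('m \<Rightarrow> 'm tvec) \<Rightarrow> ('m \<Rightarrow> 'm tvec) \<Rightarrow> ('m \<Rightarrow> 'm tvec) \<Rightarrow> 'm \<Rightarrow> real" where
  "cov_tensor D h X Y Z = (\<lambda>p.
     X p (\<lambda>q. h q (Y q) (Z q)) - h p (D X Y p) (Z p) - h p (Y p) (D X Z p))"

definition d_nabla ::
  "'m connection \<Rightarrow> ('m \<Rightarrow> 'm tvec \<Rightarrow> 'm tvec \<Rightarrow> real) \<Rightarrow>
     ('m \<Rightarrow> 'm tvec) \<Rightarrow> ('m \<Rightarrow> 'm tvec) \<Rightarrow> ('m \<Rightarrow> 'm tvec) \<Rightarrow> 'm \<Rightarrow> real" where
  "d_nabla D h X Y Z = (\<lambda>p.
     cov_tensor D h X Y Z p - cov_tensor D h Y X Z p + h p (torsion D X Y p) (Z p))"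

definition quasi_statistical ::
  "('m::topological_space, 'e::euclidean_space) chart set \<Rightarrow>
     ('m \<Rightarrow> 'm tvec \<Rightarrow> 'm tvec \<Rightarrow> real) \<Rightarrow> 'm connection \<Rightarrow> bool" where
  "quasi_statistical A h D \<longleftrightarrow>
     (\<forall>X\<in>vector_fields A. \<forall>Y\<in>vector_fields A. \<forall>Z\<in>vector_fields A. \<forall>p.
        d_nabla D h X Y Z p = 0)"


section \<open>The generalized tangent bundle\<close>

(* The element X + \<alpha> of the direct sum is the pair (X, \<alpha>). *)
definition gen_fibre ::
  "('m::topological_space, 'e::euclidean_space) chart set \<Rightarrow> 'm \<Rightarrow> ('m tvec \<times> 'm cvec) set" where
  "gen_fibre A p = tangent_space A p \<times> cotangent_space A p"

definition gen_sections ::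
  "('m::topological_space, 'e::euclidean_space) chart set \<Rightarrow>
     ('m \<Rightarrow> 'm tvec \<times> 'm cvec) set" where
  "gen_sections A = {\<sigma>. fst \<circ> \<sigma> \<in> vector_fields A \<and> snd \<circ> \<sigma> \<in> one_forms A}"

definition nabla_bracket ::
  "('m::topological_space, 'e::euclidean_space) chart set \<Rightarrow> 'm connection \<Rightarrow>
     ('m \<Rightarrow> 'm tvec \<times> 'm cvec) \<Rightarrow> ('m \<Rightarrow> 'm tvec \<times> 'm cvec) \<Rightarrow>
     'm \<Rightarrow> 'm tvec \<times> 'm cvec" where
  "nabla_bracket A D \<sigma> \<tau> = (\<lambda>p.
     (lie_bracket (fst \<circ> \<sigma>) (fst \<circ> \<tau>) p,
      cov_form A D (fst \<circ> \<sigma>) (snd \<circ> \<tau>) p - cov_form A D (fst \<circ> \<tau>) (snd \<circ> \<sigma>) p))"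

type_synonym 'm gen_endo = "'m \<Rightarrow> 'm tvec \<times> 'm cvec \<Rightarrow> 'm tvec \<times> 'm cvec"

definition on_section ::
  "'m gen_endo \<Rightarrow> ('m \<Rightarrow> 'm tvec \<times> 'm cvec) \<Rightarrow> 'm \<Rightarrow> 'm tvec \<times> 'm cvec" where
  "on_section J \<sigma> = (\<lambda>p. J p (\<sigma> p))"

definition bundle_endomorphism ::
  "('m::topological_space, 'e::euclidean_space) chart set \<Rightarrow> 'm gen_endo \<Rightarrow> bool" where
  "bundle_endomorphism A J \<longleftrightarrow>
     (\<forall>p. (\<forall>x\<in>gen_fibre A p. J p x \<in> gen_fibre A p) \<and>
          (\<forall>x\<in>gen_fibre A p. \<forall>y\<in>gen_fibre A p. J p (x + y) = J p x + J p y) \<and>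
          (\<forall>c. \<forall>x\<in>gen_fibre A p.
             J p (map_prod (scl c) (scl c) x) = map_prod (scl c) (scl c) (J p x))) \<and>
     (\<forall>\<sigma>\<in>gen_sections A. on_section J \<sigma> \<in> gen_sections A)"

definition nijenhuis ::
  "('m::topological_space, 'e::euclidean_space) chart set \<Rightarrow> 'm connection \<Rightarrow> 'm gen_endo \<Rightarrow>
     ('m \<Rightarrow> 'm tvec \<times> 'm cvec) \<Rightarrow> ('m \<Rightarrow> 'm tvec \<times> 'm cvec) \<Rightarrow>
     'm \<Rightarrow> 'm tvec \<times> 'm cvec" where
  "nijenhuis A D J \<sigma> \<tau> =
     nabla_bracket A D (on_section J \<sigma>) (on_section J \<tau>)
     - on_section J (nabla_bracket A D (on_section J \<sigma>) \<tau>)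
     - on_section J (nabla_bracket A D \<sigma> (on_section J \<tau>))
     + on_section J (on_section J (nabla_bracket A D \<sigma> \<tau>))"

definition nabla_integrable ::
  "('m::topological_space, 'e::euclidean_space) chart set \<Rightarrow> 'm connection \<Rightarrow>
     'm gen_endo \<Rightarrow> bool" where
  "nabla_integrable A D J \<longleftrightarrow>
     bundle_endomorphism A J \<and>
     ((\<forall>p. \<forall>x\<in>gen_fibre A p. J p (J p x) = x) \<or>
      (\<forall>p. \<forall>x\<in>gen_fibre A p. J p (J p x) = - x)) \<and>
     (\<forall>\<sigma>\<in>gen_sections A. \<forall>\<tau>\<in>gen_sections A. \<forall>p. nijenhuis A D J \<sigma> \<tau> p = 0)"

(* Inverse of the fibre map v \<mapsto> h p v = h(v, -) from the tangent to the cotangent space. *)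
definition h_inv ::
  "('m::topological_space, 'e::euclidean_space) chart set \<Rightarrow>
     ('m \<Rightarrow> 'm tvec \<Rightarrow> 'm tvec \<Rightarrow> real) \<Rightarrow> 'm \<Rightarrow> 'm cvec \<Rightarrow> 'm tvec" where
  "h_inv A h p = inv_into (tangent_space A p) (h p)"

definition J_c ::
  "('m::topological_space, 'e::euclidean_space) chart set \<Rightarrow>
     ('m \<Rightarrow> 'm tvec \<Rightarrow> 'm tvec \<Rightarrow> real) \<Rightarrow> 'm gen_endo" where
  "J_c A h = (\<lambda>p (v, \<xi>). (- h_inv A h p \<xi>, h p v))"

definition J_p ::
  "('m::topological_space, 'e::euclidean_space) chart set \<Rightarrow>
     ('m \<Rightarrow> 'm tvec \<Rightarrow> 'm tvec \<Rightarrow> real) \<Rightarrow> 'm gen_endo" where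
  "J_p A h = (\<lambda>p (v, \<xi>). (h_inv A h p \<xi>, h p v))"

end

theory Submission
  imports Defs
begin

text \<open>
  Put \<open>Q(X, Y) = \<nabla>\<^sub>X(hY) - \<nabla>\<^sub>Y(hX) - h[X, Y]\<close>; pairing with \<open>Z\<close> shows \<open>Q(X, Y)(Z) = (d\<^sup>\<nabla>h)(X, Y, Z)\<close>.
  Every section of the generalized tangent bundle has the form \<open>X + hA\<close>. With \<open>J(X + \<alpha>) = \<epsilon>h\<inverse>\<alpha> + hX\<close>
  and \<open>\<epsilon> = \<plusminus>1\<close>, the Nijenhuis tensor at \<open>X + hA\<close>, \<open>Y + hB\<close> has vector part
  \<open>- h\<inverse>(Q(A, B) + \<epsilon>Q(X, Y))\<close> and covector part \<open>\<epsilon>(Q(A, Y) + Q(X, B))\<close>, so it vanishes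
  identically iff \<open>Q\<close> does.

  Since tangent vectors are derivations, the tensor calculus rests on one fact: around each point
  there are global functions \<open>\<psi>, x\<^sub>b\<close> and global vector fields \<open>E\<^sub>b\<close> with \<open>\<psi>v = \<Sum>\<^sub>b v(x\<^sub>b)E\<^sub>b\<close> for all tangent
  vectors \<open>v\<close> of the whole manifold (Hadamard's lemma and cut-off functions). It yields
  finite-dimensionality, extension of vectors to fields, tensoriality of \<open>C\<^sup>\<infinity>\<close>-linear maps,
  and, by Gaussian elimination over germs, smoothness of \<open>h\<inverse>\<alpha>\<close>.
\<close>

section \<open>Calculus of smooth maps\<close>

text \<open>A tangent vector accepts only globally smooth functions, and the axioms of an affine
  connection speak only of global vector fields, so nothing can be restricted to a chart domain.
  Every local argument is instead multiplied by a cut-off function. This explains the factor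
  \<open>\<psi>\<close> in the frame identity: \<open>\<psi>v\<close> has a global expansion to
  which a function-linear map can be applied, and \<open>\<psi> p = 1\<close> removes the factor at
  the point of interest. Writing every section as X + hA has a price: the field \<open>h_inv\<close>
  of a 1-form is defined fibre by fibre through a choice function, so its smoothness must be won
  from the linear equations that it satisfies. The gain is that J merely exchanges two vector fields
  up to the constant \<open>\<epsilon>\<close>, so each bracket in the Nijenhuis tensor consists of
  Lie brackets and covariant derivatives of forms h(Z, -).\<close>

lemma Ck_on_cong:
  assumes "open S" "Ck_on k S f" "\<And>x. x \<in> S \<Longrightarrow> f x = g x"
  shows "Ck_on k S g"
  using assms(2,3)
proof (induction k arbitrary: f g)
  case 0
  then show ?case using continuous_on_cong by force
next
  case (Suc k)
  have "f differentiable_on S" using Suc.prems(1) by simp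
  then have deriv: "(g has_derivative frechet_derivative f (at x)) (at x)" if x: "x \<in> S" for x
    using x Suc.prems(2)
    by (metis has_derivative_transform_within_open assms(1) differentiable_on_eq_differentiable_at
        frechet_derivative_works)
  then have "g differentiable_on S"
    using assms(1) differentiable_on_eq_differentiable_at differentiable_def by blast
  moreover have "Ck_on k S (\<lambda>x. frechet_derivative g (at x) v)" for v
  proof (rule Suc.IH)
    show "Ck_on k S (\<lambda>x. frechet_derivative f (at x) v)"
      using Suc.prems(1) by simp
    show "frechet_derivative f (at x) v = frechet_derivative g (at x) v" if "x \<in> S" for x
      using frechet_derivative_at[OF deriv[OF that]] by (rule fun_cong)
  qed
  ultimately show ?case by simp
qed

text \<open>\<open>frechet_derivative\<close> is a chosen derivative; uniqueness of derivatives lets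
  any explicit formula \<open>f'\<close> stand in for it. Most closure rules below exhibit such a
  formula and apply the induction hypothesis to its directional values.\<close>

lemma Ck_on_SucI:
  assumes "open S" "\<And>x. x \<in> S \<Longrightarrow> (f has_derivative f' x) (at x)"
    and "\<And>v. Ck_on k S (\<lambda>x. f' x v)"
  shows "Ck_on (Suc k) S f"
  unfolding Ck_on.simps
proof (intro conjI allI)
  show "f differentiable_on S"
    using assms(1,2) by (auto simp: differentiable_on_eq_differentiable_at differentiable_def)
  show "Ck_on k S (\<lambda>x. frechet_derivative f (at x) v)" for v
    using frechet_derivative_at[OF assms(2)] by (intro Ck_on_cong[OF assms(1) assms(3)[of v]]) simp
qed

lemma Ck_on_Suc_deriv:
  assumes "open S" "Ck_on (Suc k) S f" "x \<in> S"
  shows "(f has_derivative frechet_derivative f (at x)) (at x)"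
proof -
  have "f differentiable_on S" using assms(2) by simp
  then show ?thesis
    using assms(1,3) differentiable_on_eq_differentiable_at frechet_derivative_works by blast
qed

lemma Ck_on_subset:
  assumes "Ck_on k S f" "T \<subseteq> S"
  shows "Ck_on k T f"
  using assms(1)
proof (induction k arbitrary: f)
  case 0
  then show ?case using assms(2) continuous_on_subset by force
next
  case (Suc k)
  then show ?case using assms(2) differentiable_on_subset unfolding Ck_on.simps by blast
qed

text \<open>The derivative involved is the unrestricted one, so it does not change when the open set
  shrinks.\<close>

lemma Ck_on_local:
  assumes "open S" "\<And>x. x \<in> S \<Longrightarrow> \<exists>T. open T \<and> x \<in> T \<and> Ck_on k T f"
  shows "Ck_on k S f"
  using assms(2)
proof (induction k arbitrary: f)
  case 0
  then have "isCont f x" if "x \<in> S" for x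
    using that by (metis Ck_on.simps(1) continuous_on_eq_continuous_at)
  then show ?case by (simp add: continuous_at_imp_continuous_on)
next
  case (Suc k)
  have "f differentiable at x" if "x \<in> S" for x
    using Suc.prems[OF that] by (auto simp: differentiable_on_eq_differentiable_at)
  moreover have "Ck_on k S (\<lambda>x. frechet_derivative f (at x) v)" for v
  proof (rule Suc.IH)
    fix x assume "x \<in> S"
    then show "\<exists>T. open T \<and> x \<in> T \<and> Ck_on k T (\<lambda>x. frechet_derivative f (at x) v)"
      using Suc.prems[of x] by auto
  qed
  ultimately show ?case
    using assms(1) by (simp add: differentiable_on_eq_differentiable_at)
qed

lemma Ck_on_SucD: "Ck_on (Suc k) S f \<Longrightarrow> Ck_on k S f"
proof (induction k arbitrary: f)
  case 0
  then show ?case by (simp add: differentiable_imp_continuous_on)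
next
  case (Suc k)
  have "f differentiable_on S" "Ck_on (Suc k) S (\<lambda>x. frechet_derivative f (at x) v)" for v
    using Suc.prems unfolding Ck_on.simps(2)[of "Suc k"] by blast+
  then show ?case
    using Suc.IH Ck_on.simps(2)[of k S f] by blast
qed

lemma Ck_on_const: "Ck_on k S (\<lambda>x. c)"
proof (induction k arbitrary: c)
  case (Suc k) then show ?case by simp
qed simp

lemma Ck_on_bounded_linear:
  assumes "open S" "bounded_linear L" "Ck_on k S f"
  shows "Ck_on k S (\<lambda>x. L (f x))"
  using assms(3)
proof (induction k arbitrary: f)
  case 0
  then show ?case using assms(2) by (simp add: bounded_linear.continuous_on)
next
  case (Suc k)
  show ?case
  proof (rule Ck_on_SucI[OF assms(1)])
    show "((\<lambda>x. L (f x)) has_derivative (\<lambda>v. L (frechet_derivative f (at x) v))) (at x)" if "x \<in> S" for x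
      using Ck_on_Suc_deriv[OF assms(1) Suc.prems that] assms(2)
      by (rule bounded_linear.has_derivative[rotated])
    show "Ck_on k S (\<lambda>x. L (frechet_derivative f (at x) v))" for v
      using Suc by simp
  qed
qed

lemma Ck_on_ident:
  assumes "open S"
  shows "Ck_on k S (\<lambda>x. x)"
proof (cases k)
  case 0
  then show ?thesis by simp
next
  case (Suc k)
  have "Ck_on (Suc k) S (\<lambda>x. x)"
    by (rule Ck_on_SucI[OF assms has_derivative_ident Ck_on_const])
  then show ?thesis using Suc by simp
qed

lemma Ck_on_add:
  assumes "open S" "Ck_on k S f" "Ck_on k S g"
  shows "Ck_on k S (\<lambda>x. f x + g x)"
  using assms(2,3)
proof (induction k arbitrary: f g)
  case (Suc k)
  show ?case
  proof (rule Ck_on_SucI[OF assms(1)])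
    show "((\<lambda>x. f x + g x) has_derivative
        (\<lambda>v. frechet_derivative f (at x) v + frechet_derivative g (at x) v)) (at x)" if "x \<in> S" for x
      using Suc.prems that by (intro has_derivative_add Ck_on_Suc_deriv[OF assms(1)])
    show "Ck_on k S (\<lambda>x. frechet_derivative f (at x) v + frechet_derivative g (at x) v)" for v
      using Suc by simp
  qed
qed (simp add: continuous_on_add)

lemma Ck_on_mult:
  fixes f g :: "_ \<Rightarrow> real"
  assumes "open S" "Ck_on k S f" "Ck_on k S g"
  shows "Ck_on k S (\<lambda>x. f x * g x)"
  using assms(2,3)
proof (induction k arbitrary: f g)
  case (Suc k)
  show ?case
  proof (rule Ck_on_SucI[OF assms(1)])
    show "((\<lambda>x. f x * g x) has_derivative
        (\<lambda>v. f x * frechet_derivative g (at x) v + frechet_derivative f (at x) v * g x)) (at x)"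
      if "x \<in> S" for x
      using Suc.prems that by (intro has_derivative_mult Ck_on_Suc_deriv[OF assms(1)])
    show "Ck_on k S (\<lambda>x. f x * frechet_derivative g (at x) v + frechet_derivative f (at x) v * g x)" for v
      using Suc.prems Ck_on_SucD[OF Suc.prems(1)] Ck_on_SucD[OF Suc.prems(2)]
      by (intro Ck_on_add[OF assms(1)] Suc.IH) auto
  qed
qed (simp add: continuous_on_mult)

lemma Ck_on_sum:
  assumes "open S" "\<And>i. i \<in> I \<Longrightarrow> Ck_on k S (f i)"
  shows "Ck_on k S (\<lambda>x. \<Sum>i\<in>I. f i x)"
proof (cases "finite I")
  case True
  then show ?thesis using assms(2)
    by (induction I) (auto simp: Ck_on_const intro!: Ck_on_add[OF assms(1)])
qed (simp add: Ck_on_const)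

text \<open>The derivative of 1/f is a product of f' with two copies of 1/f, so the induction
  hypothesis for the same \<open>f\<close> is enough.\<close>

lemma Ck_on_inverse:
  fixes f :: "_ \<Rightarrow> real"
  assumes "open S" "Ck_on k S f" "\<And>x. x \<in> S \<Longrightarrow> f x \<noteq> 0"
  shows "Ck_on k S (\<lambda>x. inverse (f x))"
  using assms(2)
proof (induction k)
  case 0 with assms(3) show ?case by (auto intro: continuous_on_inverse)
next
  case (Suc k)
  have IH: "Ck_on k S (\<lambda>x. inverse (f x))"
    using Suc Ck_on_SucD by blast
  show ?case
  proof (rule Ck_on_SucI[OF assms(1)])
    show "((\<lambda>x. inverse (f x)) has_derivative
        (\<lambda>v. - (inverse (f x) * frechet_derivative f (at x) v * inverse (f x)))) (at x)"
      if "x \<in> S" for x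
      using that Suc.prems assms(3) by (intro Deriv.has_derivative_inverse Ck_on_Suc_deriv[OF assms(1)])
    show "Ck_on k S (\<lambda>x. - (inverse (f x) * frechet_derivative f (at x) v * inverse (f x)))" for v
      using Suc.prems IH
      by (intro Ck_on_mult[OF assms(1)] Ck_on_bounded_linear[OF assms(1), where L = uminus])
        (auto intro: bounded_linear_minus bounded_linear_ident)
  qed
qed

lemma Ck_on_compose:
  fixes f :: "'e::euclidean_space \<Rightarrow> 'f::euclidean_space" and g :: "'f \<Rightarrow> real"
  assumes "open S" "open T" "f ` S \<subseteq> T" "Ck_on k S f" "Ck_on k T g"
  shows "Ck_on k S (\<lambda>x. g (f x))"
  using assms(4,5)
proof (induction k arbitrary: g)
  case 0
  then show ?case using assms(3) by (auto intro: continuous_on_compose2)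
next
  case (Suc k)
  let ?D = "frechet_derivative"
  have k: "Ck_on k S f" using Suc.prems Ck_on_SucD by blast
  show ?case
  proof (rule Ck_on_SucI[OF assms(1)])
    fix x assume x: "x \<in> S"
    have g: "(g has_derivative ?D g (at (f x))) (at (f x))"
      using x assms(3) Suc.prems(2) by (intro Ck_on_Suc_deriv[OF assms(2)]) auto
    have chain: "((\<lambda>x. g (f x)) has_derivative (\<lambda>v. ?D g (at (f x)) (?D f (at x) v))) (at x)"
      using diff_chain_at[OF Ck_on_Suc_deriv[OF assms(1) Suc.prems(1) x] g] by (simp add: o_def)
    \<comment> \<open>\<open>Ck_on\<close> differentiates in a fixed direction, but here the
      direction \<open>?D f (at x) v\<close> moves with \<open>x\<close>. Expansion in the basis
      leaves fixed directions with coefficients depending on \<open>x\<close>, to which the sum and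
      product rules apply.\<close>
    have coords: "?D g (at (f x)) w = (\<Sum>b\<in>Basis. (w \<bullet> b) * ?D g (at (f x)) b)" for w
    proof -
      interpret linear "?D g (at (f x))" using g has_derivative_linear by blast
      have "?D g (at (f x)) w = ?D g (at (f x)) (\<Sum>b\<in>Basis. (w \<bullet> b) *\<^sub>R b)"
        by (simp add: euclidean_representation)
      also have "\<dots> = (\<Sum>b\<in>Basis. (w \<bullet> b) * ?D g (at (f x)) b)"
        by (simp add: sum scaleR)
      finally show ?thesis .
    qed
    show "((\<lambda>x. g (f x)) has_derivative
        (\<lambda>v. \<Sum>b\<in>Basis. (?D f (at x) v \<bullet> b) * ?D g (at (f x)) b)) (at x)"
      by (rule has_derivative_eq_rhs[OF chain ext]) (rule coords)
  next
    fix v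
    have "Ck_on k S (\<lambda>x. ?D f (at x) v \<bullet> b)" for b
      using Suc.prems(1) by (intro Ck_on_bounded_linear[OF assms(1) bounded_linear_inner_left]) simp
    moreover have "Ck_on k S (\<lambda>x. ?D g (at (f x)) b)" for b
      using Suc.prems(2) by (intro Suc.IH k) simp
    ultimately show "Ck_on k S (\<lambda>x. \<Sum>b\<in>Basis. (?D f (at x) v \<bullet> b) * ?D g (at (f x)) b)"
      by (intro Ck_on_sum[OF assms(1)] Ck_on_mult[OF assms(1)])
  qed
qed

section \<open>Closure properties of infinitely differentiable maps\<close>

lemma smooth_on_cong:
  "open S \<Longrightarrow> smooth_on S f \<Longrightarrow> (\<And>x. x \<in> S \<Longrightarrow> f x = g x) \<Longrightarrow> smooth_on S g"
  unfolding smooth_on_def using Ck_on_cong by blast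

lemma smooth_on_subset: "smooth_on S f \<Longrightarrow> T \<subseteq> S \<Longrightarrow> smooth_on T f"
  unfolding smooth_on_def using Ck_on_subset by blast

lemma smooth_on_local:
  "open S \<Longrightarrow> (\<And>x. x \<in> S \<Longrightarrow> \<exists>T. open T \<and> x \<in> T \<and> smooth_on T f) \<Longrightarrow> smooth_on S f"
  unfolding smooth_on_def using Ck_on_local by meson

lemma smooth_on_const: "smooth_on S (\<lambda>x. c)"
  by (simp add: smooth_on_def Ck_on_const)

lemma smooth_on_ident: "open S \<Longrightarrow> smooth_on S (\<lambda>x. x)"
  by (simp add: smooth_on_def Ck_on_ident)

lemma smooth_on_bounded_linear:
  "open S \<Longrightarrow> bounded_linear L \<Longrightarrow> smooth_on S f \<Longrightarrow> smooth_on S (\<lambda>x. L (f x))"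
  by (simp add: smooth_on_def Ck_on_bounded_linear)

lemma smooth_on_add:
  "open S \<Longrightarrow> smooth_on S f \<Longrightarrow> smooth_on S g \<Longrightarrow> smooth_on S (\<lambda>x. f x + g x)"
  by (simp add: smooth_on_def Ck_on_add)

lemma smooth_on_sum:
  "open S \<Longrightarrow> (\<And>i. i \<in> I \<Longrightarrow> smooth_on S (f i)) \<Longrightarrow> smooth_on S (\<lambda>x. \<Sum>i\<in>I. f i x)"
  by (simp add: smooth_on_def Ck_on_sum)

lemma smooth_on_mult:
  fixes f g :: "_ \<Rightarrow> real"
  shows "open S \<Longrightarrow> smooth_on S f \<Longrightarrow> smooth_on S g \<Longrightarrow> smooth_on S (\<lambda>x. f x * g x)"
  by (simp add: smooth_on_def Ck_on_mult)

lemma smooth_on_inverse: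
  fixes f :: "_ \<Rightarrow> real"
  shows "open S \<Longrightarrow> smooth_on S f \<Longrightarrow> (\<And>x. x \<in> S \<Longrightarrow> f x \<noteq> 0) \<Longrightarrow> smooth_on S (\<lambda>x. inverse (f x))"
  by (simp add: smooth_on_def Ck_on_inverse)

lemma smooth_on_compose:
  fixes f :: "'e::euclidean_space \<Rightarrow> 'f::euclidean_space" and g :: "'f \<Rightarrow> real"
  shows "open S \<Longrightarrow> open T \<Longrightarrow> f ` S \<subseteq> T \<Longrightarrow> smooth_on S f \<Longrightarrow> smooth_on T g \<Longrightarrow>
    smooth_on S (\<lambda>x. g (f x))"
  by (simp add: smooth_on_def Ck_on_compose)

lemma smooth_on_deriv:
  "smooth_on S f \<Longrightarrow> smooth_on S (\<lambda>x. frechet_derivative f (at x) v)"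
  unfolding smooth_on_def by (metis Ck_on.simps(2))

lemma smooth_on_has_derivative:
  "open S \<Longrightarrow> smooth_on S f \<Longrightarrow> x \<in> S \<Longrightarrow> (f has_derivative frechet_derivative f (at x)) (at x)"
  unfolding smooth_on_def using Ck_on_Suc_deriv by blast

section \<open>Bump functions\<close>

text \<open>The functions x^(-n) exp(-1/x), extended by 0 to the left. Up to linear combinations the
  family is closed under differentiation, so one induction makes all of them smooth; the cut-offs
  are built from \<open>flat 0\<close>.\<close>

definition flat :: "nat \<Rightarrow> real \<Rightarrow> real" where
  "flat n x = (if x > 0 then inverse x ^ n * exp (- inverse x) else 0)"

text \<open>With y = 1/x the limit from the right is that of y^n / exp y at infinity.\<close>

lemma flat_tendsto_0: "(flat n \<longlongrightarrow> 0) (at 0)"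
proof -
  have "((\<lambda>x. x ^ n / exp x) \<longlongrightarrow> (0::real)) at_top"
    by (rule tendsto_power_div_exp_0)
  then have "((\<lambda>x. inverse x ^ n / exp (inverse x)) \<longlongrightarrow> (0::real)) (at_right 0)"
    by (rule filterlim_compose[OF _ filterlim_inverse_at_top_right])
  moreover have "\<forall>\<^sub>F x in at_right 0. inverse x ^ n / exp (inverse x) = flat n x"
    using eventually_at_right_less
    by (rule eventually_mono) (simp add: flat_def exp_minus divide_inverse)
  ultimately have right: "(flat n \<longlongrightarrow> 0) (at_right 0)"
    by (rule Lim_transform_eventually)
  have "\<forall>\<^sub>F x in at_left 0. flat n x = 0"
    unfolding eventually_at_filter by (simp add: flat_def)
  then have left: "(flat n \<longlongrightarrow> 0) (at_left 0)"
    by (rule tendsto_eventually)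
  show ?thesis
    using left right by (rule filterlim_split_at)
qed

lemma flat_deriv: "(flat n has_real_derivative flat (n + 2) x - n * flat (n + 1) x) (at x)"
proof (cases x "0 :: real" rule: linorder_cases)
  case less
  have "((\<lambda>x. 0) has_real_derivative 0) (at x)" by simp
  then have "(flat n has_real_derivative 0) (at x)"
    by (rule has_field_derivative_transform_within_open[of _ _ _ "{..<0}"])
      (use less in \<open>auto simp: flat_def\<close>)
  moreover have "flat (n + 2) x - n * flat (n + 1) x = 0" using less by (simp add: flat_def)
  ultimately show ?thesis by metis
next
  case greater
  define y where "y = inverse x"
  have "((\<lambda>x. inverse x ^ n * exp (- inverse x)) has_real_derivative
      n * y ^ (n - 1) * - (y * y) * exp (- y) + y ^ n * (exp (- y) * (y * y))) (at x)"
    unfolding y_def using greater by (auto intro!: derivative_eq_intros)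
  also have "n * y ^ (n - 1) * - (y * y) * exp (- y) + y ^ n * (exp (- y) * (y * y)) =
      flat (n + 2) x - n * flat (n + 1) x"
    \<comment> \<open>At \<open>n = 0\<close> the exponent \<open>n - 1\<close> is truncated, but
      the factor \<open>n\<close> removes that term.\<close>
    using greater by (cases n) (simp_all add: flat_def y_def[symmetric] algebra_simps)
  finally have "((\<lambda>x. inverse x ^ n * exp (- inverse x)) has_real_derivative
      flat (n + 2) x - n * flat (n + 1) x) (at x)" .
  then show ?thesis
    by (rule has_field_derivative_transform_within_open[of _ _ _ "{0<..}"])
      (use greater in \<open>auto simp: flat_def\<close>)
next
  case equal
  \<comment> \<open>The difference quotient at 0 is again a member of the family. At
    \<open>h = 0\<close> both sides are 0, the left one by the convention for division by
    zero.\<close>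
  have "(\<lambda>h. (flat n (0 + h) - flat n 0) / h) = flat (Suc n)"
    by (auto simp: flat_def fun_eq_iff divide_simps)
  then have "(flat n has_real_derivative 0) (at 0)"
    using flat_tendsto_0[of "Suc n"] unfolding DERIV_def by simp
  moreover have "flat (n + 2) x - n * flat (n + 1) x = 0" using equal by (simp add: flat_def)
  ultimately show ?thesis using equal by metis
qed

lemma Ck_on_flat: "Ck_on k UNIV (flat n)"
proof (induction k arbitrary: n)
  case 0
  have "isCont (flat n) x" for x using flat_deriv DERIV_isCont by blast
  then show ?case by (simp add: continuous_at_imp_continuous_on)
next
  case (Suc k)
  show ?case
  proof (rule Ck_on_SucI)
    show "(flat n has_derivative (\<lambda>v. (flat (n + 2) x + (- real n) * flat (n + 1) x) * v)) (at x)" for x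
      using flat_deriv[of n x] by (simp add: has_field_derivative_def)
    show "Ck_on k UNIV (\<lambda>x. (flat (n + 2) x + (- real n) * flat (n + 1) x) * v)" for v
      by (intro Ck_on_mult Ck_on_add Ck_on_const Suc.IH open_UNIV)
  qed simp
qed

lemma flat_nonneg: "0 \<le> flat n x"
  and flat_pos_iff: "0 < flat n x \<longleftrightarrow> 0 < x"
  by (auto simp: flat_def)

text \<open>The squared distance is polynomial, unlike the distance. The sign of \<open>d\<close>
  decides whether the function is positive on a ball or on the complement of one.\<close>

lemma smooth_on_flat_norm:
  "smooth_on UNIV (\<lambda>y :: 'e::euclidean_space. flat 0 (c + d * ((y - a) \<bullet> (y - a))))"
proof -
  have "smooth_on UNIV (\<lambda>y. (y - a) \<bullet> b)" for b
    using smooth_on_add[OF open_UNIV smooth_on_bounded_linear[OF open_UNIV bounded_linear_inner_left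
          smooth_on_ident[OF open_UNIV], of b] smooth_on_const[of _ "- (a \<bullet> b)"]]
    by (simp add: inner_diff_left)
  then have "smooth_on UNIV (\<lambda>y. c + d * (\<Sum>b\<in>Basis. ((y - a) \<bullet> b) * ((y - a) \<bullet> b)))"
    by (intro smooth_on_add smooth_on_mult smooth_on_sum smooth_on_const open_UNIV)
  then have "smooth_on UNIV (\<lambda>y. c + d * ((y - a) \<bullet> (y - a)))"
    by (subst euclidean_inner) simp
  moreover have "smooth_on UNIV (flat 0)"
    by (simp add: smooth_on_def Ck_on_flat)
  ultimately show ?thesis
    using smooth_on_compose[OF open_UNIV open_UNIV subset_UNIV] by blast
qed

lemma bump_function:
  fixes a :: "'e::euclidean_space"
  assumes "0 < r"
  obtains f where "smooth_on UNIV f" "f a = (1::real)" "\<And>y. y \<notin> ball a r \<Longrightarrow> f y = 0"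
proof -
  let ?g = "\<lambda>y. flat 0 (r\<^sup>2 + (- 1) * ((y - a) \<bullet> (y - a)))"
  let ?f = "\<lambda>y. inverse (?g a) * ?g y"
  have "0 < ?g a" using assms by (simp add: flat_pos_iff)
  then have "?f a = 1" by simp
  moreover have "smooth_on UNIV ?f"
    by (rule smooth_on_mult[OF open_UNIV smooth_on_const smooth_on_flat_norm])
  moreover have "?f y = 0" if "y \<notin> ball a r" for y
  proof -
    have "r \<le> norm (y - a)" using that by (simp add: dist_norm norm_minus_commute)
    then have "r\<^sup>2 \<le> (norm (y - a))\<^sup>2" using assms by (intro power_mono) auto
    then show ?thesis by (simp add: power2_norm_eq_inner flat_def)
  qed
  ultimately show thesis using that[of ?f] by blast
qed

text \<open>The quotient g / (g + h), where g is positive exactly on the open ball of radius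
  \<open>R\<close> and h exactly off the closed ball of radius \<open>r\<close>. As
  \<open>r < R\<close>, these sets cover the space and the denominator never vanishes.\<close>

lemma plateau_function:
  fixes a :: "'e::euclidean_space"
  assumes "0 < r" "r < R"
  obtains f where "smooth_on UNIV f" "\<And>y. y \<in> cball a r \<Longrightarrow> f y = (1::real)"
    "\<And>y. y \<notin> ball a R \<Longrightarrow> f y = 0"
proof -
  let ?q = "\<lambda>y. (y - a) \<bullet> (y - a)"
  let ?g = "\<lambda>y. flat 0 (R\<^sup>2 + (- 1) * ?q y)" and ?h = "\<lambda>y. flat 0 (- r\<^sup>2 + 1 * ?q y)"
  let ?f = "\<lambda>y. ?g y * inverse (?g y + ?h y)"
  have "r\<^sup>2 < R\<^sup>2" using assms by (intro power_strict_mono) auto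
  have pos: "0 < ?g y + ?h y" for y
  proof (cases "?q y < R\<^sup>2")
    case True
    then have "0 < ?g y" by (simp add: flat_pos_iff)
    then show ?thesis using flat_nonneg by (rule add_pos_nonneg)
  next
    case False
    then have "0 < ?h y" using \<open>r\<^sup>2 < R\<^sup>2\<close> by (simp add: flat_pos_iff)
    then show ?thesis using flat_nonneg by (intro add_nonneg_pos)
  qed
  have "?g y + ?h y \<noteq> 0" for y
    using pos[of y] by simp
  then have "smooth_on UNIV (\<lambda>y. inverse (?g y + ?h y))"
    by (rule smooth_on_inverse[OF open_UNIV
          smooth_on_add[OF open_UNIV smooth_on_flat_norm smooth_on_flat_norm]])
  then have "smooth_on UNIV ?f"
    by (rule smooth_on_mult[OF open_UNIV smooth_on_flat_norm])
  moreover have "?f y = 1" if "y \<in> cball a r" for y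
  proof -
    have "norm (y - a) \<le> r" using that by (simp add: dist_norm norm_minus_commute)
    then have "(norm (y - a))\<^sup>2 \<le> r\<^sup>2" by (intro power_mono) auto
    then have "?h y = 0" by (simp add: power2_norm_eq_inner flat_def)
    then show ?thesis using pos[of y] by simp
  qed
  moreover have "?f y = 0" if "y \<notin> ball a R" for y
  proof -
    have "R \<le> norm (y - a)" using that by (simp add: dist_norm norm_minus_commute)
    then have "R\<^sup>2 \<le> (norm (y - a))\<^sup>2" using assms by (intro power_mono) auto
    then show ?thesis by (simp add: power2_norm_eq_inner flat_def)
  qed
  ultimately show thesis using that[of ?f] by blast
qed

section \<open>The Hadamard lemma\<close>

lemma segment_in_ball:
  fixes a :: "'e::real_normed_vector"
  assumes "y \<in> ball a r" "t \<in> {0..1::real}"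
  shows "a + t *\<^sub>R (y - a) \<in> ball a r"
proof -
  have "norm (t *\<^sub>R (y - a)) \<le> norm (y - a)"
    using assms(2) by (simp add: mult_left_le_one_le)
  then show ?thesis using assms(1) by (simp add: dist_norm norm_minus_commute)
qed

text \<open>Scalar multiplication replaces the product because \<open>f\<close> will also be a
  derivative, with bounded linear maps as values.\<close>

lemma continuous_on_ray:
  fixes a :: "'e::real_normed_vector" and f :: "'e \<Rightarrow> 'b::real_normed_vector"
  assumes "continuous_on (ball a r) f"
  shows "continuous_on (ball a r \<times> {0..1}) (\<lambda>(x, t). t ^ m *\<^sub>R f (a + t *\<^sub>R (x - a)))"
  unfolding case_prod_beta
proof (intro continuous_intros)
  show "continuous_on (ball a r \<times> {0..1}) (\<lambda>x. f (a + snd x *\<^sub>R (fst x - a)))"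
    using segment_in_ball[of _ a r]
    by (intro continuous_on_compose2[OF assms]) (auto intro!: continuous_intros)
qed

text \<open>Differentiation under the integral brings out one factor \<open>t\<close> from the inner
  map a + t(x - a). The weight \<open>t ^ m\<close> absorbs it and keeps this class of integrals
  closed under differentiation; \<open>hadamard\<close> is the case m = 0.\<close>

lemma Ck_on_ray_integral:
  fixes a :: "'e::euclidean_space" and f :: "'e \<Rightarrow> real"
  assumes "Ck_on k (ball a r) f"
  shows "Ck_on k (ball a r) (\<lambda>x. integral {0..1} (\<lambda>t. t ^ m *\<^sub>R f (a + t *\<^sub>R (x - a))))"
  using assms
proof (induction k arbitrary: m f)
  case 0
  then show ?case
    using integral_continuous_on_param[of "ball a r" "0::real" 1 "\<lambda>x t. t ^ m *\<^sub>R f (a + t *\<^sub>R (x - a))"]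
      continuous_on_ray[of a r f m] by simp
next
  case (Suc k)
  let ?D = "\<lambda>x. frechet_derivative f (at x)" and ?B = "ball a r"
  \<comment> \<open>The Leibniz rule for parameter integrals asks for the derivative as a continuous
    map into bounded linear maps. In finite dimension that continuity follows from the continuity of
    the directional values.\<close>
  define L where "L x = Blinfun (?D x)" for x
  have deriv: "(f has_derivative ?D x) (at x)" if "x \<in> ?B" for x
    using Ck_on_Suc_deriv[OF open_ball Suc.prems that] .
  then have L: "blinfun_apply (L x) = ?D x" if "x \<in> ?B" for x
    using that has_derivative_bounded_linear unfolding L_def by (blast intro: bounded_linear_Blinfun_apply)
  have Ck: "Ck_on k ?B (\<lambda>x. ?D x v)" for v
    using Suc.prems by simp
  have cont_D: "continuous_on ?B (\<lambda>x. ?D x v)" for v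
    using Ck[of v] by (metis Ck_on.simps(1) Ck_on_SucD not0_implies_Suc Ck_on_Suc_deriv Suc.prems
        differentiable_imp_continuous_on Ck_on.simps(2))
  then have "continuous_on ?B (\<lambda>x. L x v)" for v
    using L by (metis (mono_tags, lifting) continuous_on_cong)
  then have contL: "continuous_on ?B L"
    by (intro continuous_on_blinfun_componentwise)
  have cont: "continuous_on {0..1} (\<lambda>t. t ^ j *\<^sub>R g (a + t *\<^sub>R (x - a)))"
    if "x \<in> ?B" "continuous_on ?B g" for x j and g :: "'e \<Rightarrow> 'c::real_normed_vector"
  proof -
    have "continuous_on {0..1} (\<lambda>t. (x, t))" "(\<lambda>t. (x, t)) ` {0..1} \<subseteq> ?B \<times> {0..1::real}"
      using that(1) by (auto intro!: continuous_intros)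
    from continuous_on_compose2[OF continuous_on_ray[OF that(2), of j] this] show ?thesis by simp
  qed
  have contf: "continuous_on ?B f"
    using Suc.prems differentiable_imp_continuous_on by auto
  show ?case
  proof (rule Ck_on_SucI)
    fix x assume x: "x \<in> ?B"
    have ray: "((\<lambda>x. t ^ m *\<^sub>R f (a + t *\<^sub>R (x - a))) has_derivative
        blinfun_apply (t ^ Suc m *\<^sub>R L (a + t *\<^sub>R (x - a)))) (at x within ?B)"
      if "x \<in> ?B" "t \<in> cbox 0 1" for x t
    proof -
      have s: "a + t *\<^sub>R (x - a) \<in> ?B" using that segment_in_ball by simp
      have "((\<lambda>x. a + t *\<^sub>R (x - a)) has_derivative (\<lambda>v. t *\<^sub>R v)) (at x)"
        by (auto intro!: derivative_eq_intros)
      from diff_chain_at[OF this deriv[OF s]]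
      have "((\<lambda>x. f (a + t *\<^sub>R (x - a))) has_derivative (\<lambda>v. ?D (a + t *\<^sub>R (x - a)) (t *\<^sub>R v))) (at x)"
        by (simp add: o_def)
      then have "((\<lambda>x. t ^ m *\<^sub>R f (a + t *\<^sub>R (x - a))) has_derivative
          (\<lambda>v. t ^ m *\<^sub>R ?D (a + t *\<^sub>R (x - a)) (t *\<^sub>R v))) (at x)"
        by (rule has_derivative_scaleR_right)
      moreover have "blinfun_apply (t ^ Suc m *\<^sub>R L (a + t *\<^sub>R (x - a))) =
          (\<lambda>v. t ^ m *\<^sub>R ?D (a + t *\<^sub>R (x - a)) (t *\<^sub>R v))"
        using linear_cmul[OF has_derivative_linear[OF deriv[OF s]], of t]
        by (simp add: fun_eq_iff blinfun.scaleR_left L[OF s])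
      ultimately show ?thesis by (metis has_derivative_at_withinI)
    qed
    have "((\<lambda>x. integral (cbox 0 1) (\<lambda>t. t ^ m *\<^sub>R f (a + t *\<^sub>R (x - a)))) has_derivative
        blinfun_apply (integral (cbox 0 1) (\<lambda>t. t ^ Suc m *\<^sub>R L (a + t *\<^sub>R (x - a))))) (at x within ?B)"
    proof (rule leibniz_rule[OF ray _ _ x convex_ball])
      show "(\<lambda>t. t ^ m *\<^sub>R f (a + t *\<^sub>R (y - a))) integrable_on cbox 0 1" if "y \<in> ?B" for y
        using cont[OF that contf] by (intro integrable_continuous) simp
      show "continuous_on (?B \<times> cbox 0 1) (\<lambda>(x, t). t ^ Suc m *\<^sub>R L (a + t *\<^sub>R (x - a)))"
        using continuous_on_ray[OF contL, of "Suc m"] by simp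
    qed
    moreover have "blinfun_apply (integral (cbox 0 1) (\<lambda>t. t ^ Suc m *\<^sub>R L (a + t *\<^sub>R (x - a)))) =
        (\<lambda>v. integral {0..1} (\<lambda>t. t ^ Suc m *\<^sub>R ?D (a + t *\<^sub>R (x - a)) v))"
    proof
      fix v
      have "(\<lambda>t. t ^ Suc m *\<^sub>R L (a + t *\<^sub>R (x - a))) integrable_on cbox 0 1"
        using cont[OF x contL, of "Suc m"] by (intro integrable_continuous) simp
      then have "blinfun_apply (integral (cbox 0 1) (\<lambda>t. t ^ Suc m *\<^sub>R L (a + t *\<^sub>R (x - a)))) v =
          integral (cbox 0 1) (\<lambda>t. (t ^ Suc m *\<^sub>R L (a + t *\<^sub>R (x - a))) v)"
        by (rule blinfun_apply_integral)
      also have "\<dots> = integral {0..1} (\<lambda>t. t ^ Suc m *\<^sub>R ?D (a + t *\<^sub>R (x - a)) v)"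
        using L[OF segment_in_ball[OF x]] by (auto intro!: integral_cong simp: blinfun.scaleR_left)
      finally show "blinfun_apply (integral (cbox 0 1) (\<lambda>t. t ^ Suc m *\<^sub>R L (a + t *\<^sub>R (x - a)))) v = \<dots>" .
    qed
    ultimately show "((\<lambda>x. integral {0..1} (\<lambda>t. t ^ m *\<^sub>R f (a + t *\<^sub>R (x - a)))) has_derivative
        (\<lambda>v. integral {0..1} (\<lambda>t. t ^ Suc m *\<^sub>R ?D (a + t *\<^sub>R (x - a)) v))) (at x)"
      using at_within_open[OF x open_ball] by simp
  next
    show "Ck_on k ?B (\<lambda>x. integral {0..1} (\<lambda>t. t ^ Suc m *\<^sub>R ?D (a + t *\<^sub>R (x - a)) v))" for v
      by (rule Suc.IH[OF Ck])
  qed simp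
qed

text \<open>f(y) - f(a) is the integral over [0, 1] of the derivative of f(a + t(y - a)) in t.
  Expanding the direction y - a in the basis gives \<open>g b\<close> as the mean of a partial
  derivative along the segment.\<close>

lemma hadamard:
  fixes a :: "'e::euclidean_space" and f :: "'e \<Rightarrow> real"
  assumes "smooth_on (ball a r) f" "0 < r"
  obtains g where "\<And>b. smooth_on (ball a r) (g b)"
    "\<And>b. g b a = frechet_derivative f (at a) b"
    "\<And>y. y \<in> ball a r \<Longrightarrow> f y = f a + (\<Sum>b\<in>Basis. ((y - a) \<bullet> b) * g b y)"
proof
  let ?D = "\<lambda>x. frechet_derivative f (at x)" and ?B = "ball a r"
  let ?g = "\<lambda>b x. integral {0..1} (\<lambda>t. t ^ 0 *\<^sub>R ?D (a + t *\<^sub>R (x - a)) b)"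
  show "smooth_on ?B (?g b)" for b
    using smooth_on_deriv[OF assms(1), of b] Ck_on_ray_integral[of _ a r "\<lambda>x. ?D x b" 0]
    unfolding smooth_on_def by blast
  show "?g b a = ?D a b" for b by simp
  fix y assume y: "y \<in> ?B"
  have deriv: "(f has_derivative ?D x) (at x)" if "x \<in> ?B" for x
    using smooth_on_has_derivative[OF open_ball assms(1) that] .
  have "((\<lambda>t. f (a + t *\<^sub>R (y - a))) has_vector_derivative ?D (a + t *\<^sub>R (y - a)) (y - a)) (at t within {0..1})"
    if "t \<in> {0..1}" for t
  proof -
    note s = segment_in_ball[OF y that]
    have "((\<lambda>t. a + t *\<^sub>R (y - a)) has_derivative (\<lambda>v. v *\<^sub>R (y - a))) (at t)"
      by (auto intro!: derivative_eq_intros)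
    from diff_chain_at[OF this deriv[OF s]]
    have "((\<lambda>t. f (a + t *\<^sub>R (y - a))) has_derivative (\<lambda>v. ?D (a + t *\<^sub>R (y - a)) (v *\<^sub>R (y - a)))) (at t)"
      by (simp add: o_def)
    then show ?thesis
      using linear_cmul[OF has_derivative_linear[OF deriv[OF s]]]
      by (simp add: has_vector_derivative_def has_derivative_at_withinI)
  qed
  from fundamental_theorem_of_calculus[OF _ this]
  have "((\<lambda>t. ?D (a + t *\<^sub>R (y - a)) (y - a)) has_integral f y - f a) {0..1}" by simp
  then have "f y - f a = integral {0..1} (\<lambda>t. ?D (a + t *\<^sub>R (y - a)) (y - a))"
    by (simp add: integral_unique)
  also have "\<dots> = integral {0..1} (\<lambda>t. \<Sum>b\<in>Basis. ((y - a) \<bullet> b) * ?D (a + t *\<^sub>R (y - a)) b)"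
  proof (rule integral_cong)
    fix t :: real assume "t \<in> {0..1}"
    then interpret linear "?D (a + t *\<^sub>R (y - a))"
      using deriv[OF segment_in_ball[OF y]] has_derivative_linear by blast
    show "?D (a + t *\<^sub>R (y - a)) (y - a) = (\<Sum>b\<in>Basis. ((y - a) \<bullet> b) * ?D (a + t *\<^sub>R (y - a)) b)"
      by (subst (2) euclidean_representation[symmetric]) (simp add: sum scaleR)
  qed
  also have "\<dots> = (\<Sum>b\<in>Basis. integral {0..1} (\<lambda>t. ((y - a) \<bullet> b) * ?D (a + t *\<^sub>R (y - a)) b))"
  proof (rule integral_sum)
    fix b
    have "continuous_on ?B (\<lambda>x. ?D x b)"
      using smooth_on_deriv[OF assms(1), of b] unfolding smooth_on_def by (metis Ck_on.simps(1))
    then have "continuous_on {0..1} (\<lambda>t. ?D (a + t *\<^sub>R (y - a)) b)"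
      using segment_in_ball[OF y] by (auto intro!: continuous_on_compose2[of ?B] continuous_intros)
    then show "(\<lambda>t. ((y - a) \<bullet> b) * ?D (a + t *\<^sub>R (y - a)) b) integrable_on {0..1}"
      by (intro integrable_continuous_interval continuous_intros)
  qed simp
  finally show "f y = f a + (\<Sum>b\<in>Basis. ((y - a) \<bullet> b) * ?g b y)" by simp
qed

section \<open>Smooth functions on a manifold\<close>

locale manifold =
  fixes A :: "('m::{t2_space, second_countable_topology}, 'e::euclidean_space) chart set"
  assumes atlas: "smooth_atlas A"
begin

abbreviation "C \<equiv> smooth_functions A"
abbreviation "TM \<equiv> tangent_space A"
abbreviation "TM' \<equiv> cotangent_space A"
abbreviation "VM \<equiv> vector_fields A"
abbreviation "FM \<equiv> one_forms A"

section \<open>Charts as homeomorphisms\<close>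

lemma chart_homeomorphism:
  assumes "(U, \<phi>) \<in> A"
  shows "open U" "open (\<phi> ` U)" "homeomorphism U (\<phi> ` U) \<phi> (inv_into U \<phi>)"
  using assms atlas unfolding smooth_atlas_def is_chart_def by auto

lemma chart_continuous:
  assumes "(U, \<phi>) \<in> A"
  shows "continuous_on U \<phi>" "continuous_on (\<phi> ` U) (inv_into U \<phi>)"
  using homeomorphism_cont1[OF chart_homeomorphism(3)[OF assms]]
    homeomorphism_cont2[OF chart_homeomorphism(3)[OF assms]] .

lemma chart_inv: "(U, \<phi>) \<in> A \<Longrightarrow> q \<in> U \<Longrightarrow> inv_into U \<phi> (\<phi> q) = q"
  using homeomorphism_apply1[OF chart_homeomorphism(3)] .

lemma ex_chart: "\<exists>U \<phi>. (U, \<phi>) \<in> A \<and> p \<in> U"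
  using atlas unfolding smooth_atlas_def by (metis UNIV_I UN_E prod.collapse)

lemma chart_image_open:
  assumes "(U, \<phi>) \<in> A" "open W"
  shows "open (\<phi> ` (U \<inter> W))"
proof -
  note h = chart_homeomorphism[OF assms(1)]
  have "openin (top_of_set (\<phi> ` U)) (\<phi> ` (U \<inter> W))"
    by (rule homeomorphism_imp_open_map[OF h(3)]) (use assms(2) in auto)
  then show ?thesis using h(2) openin_open_eq by blast
qed

lemma chart_preimage_open:
  assumes "(U, \<phi>) \<in> A" "open S"
  shows "open {q \<in> U. \<phi> q \<in> S}"
proof -
  note h = chart_homeomorphism[OF assms(1)]
  have "{q \<in> U. \<phi> q \<in> S} = U \<inter> \<phi> -` S" by auto
  then show ?thesis
    using continuous_open_preimage[OF chart_continuous(1)[OF assms(1)] h(1) assms(2)] by simp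
qed

text \<open>Smoothness of a germ at \<open>p\<close>, expressed for functions on the whole manifold;
  one neighbourhood \<open>W\<close> serves all charts. Division and the solution of linear systems
  take place at this level, where a denominator has to be nonzero only near
  \<open>p\<close>.\<close>

definition smooth_near :: "'m \<Rightarrow> ('m \<Rightarrow> real) \<Rightarrow> bool" where
  "smooth_near p f \<longleftrightarrow> (\<exists>W. open W \<and> p \<in> W \<and>
     (\<forall>(U, \<phi>)\<in>A. smooth_on (\<phi> ` (U \<inter> W)) (\<lambda>y. f (inv_into U \<phi> y))))"

lemma smooth_near_on:
  assumes "open W" "p \<in> W"
    "\<And>U \<phi>. (U, \<phi>) \<in> A \<Longrightarrow> smooth_on (\<phi> ` (U \<inter> W)) (\<lambda>y. f (inv_into U \<phi> y))"
  shows "smooth_near p f"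
  using assms unfolding smooth_near_def by blast

lemma smooth_functions_iff: "f \<in> C \<longleftrightarrow> (\<forall>p. smooth_near p f)"
proof
  assume "f \<in> C"
  then have "smooth_on (\<phi> ` (U \<inter> UNIV)) (\<lambda>y. f (inv_into U \<phi> y))" if "(U, \<phi>) \<in> A" for U \<phi>
    using that unfolding smooth_functions_def by (auto simp: o_def)
  then show "\<forall>p. smooth_near p f"
    using smooth_near_on[OF open_UNIV UNIV_I] by blast
next
  assume f: "\<forall>p. smooth_near p f"
  have "smooth_on (\<phi> ` U) (\<lambda>y. f (inv_into U \<phi> y))" if c: "(U, \<phi>) \<in> A" for U \<phi>
  proof (rule smooth_on_local[OF chart_homeomorphism(2)[OF c]])
    fix y assume "y \<in> \<phi> ` U"
    then obtain q where q: "q \<in> U" "y = \<phi> q" by blast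
    obtain W where W: "open W" "q \<in> W" "smooth_on (\<phi> ` (U \<inter> W)) (\<lambda>y. f (inv_into U \<phi> y))"
      using f c unfolding smooth_near_def by blast
    then show "\<exists>T. open T \<and> y \<in> T \<and> smooth_on T (\<lambda>y. f (inv_into U \<phi> y))"
      using q chart_image_open[OF c W(1)] by blast
  qed
  then show "f \<in> C" unfolding smooth_functions_def o_def by blast
qed

lemma smooth_near_binary:
  assumes f: "smooth_near p f" and g: "smooth_near p g"
    and op: "\<And>(S :: 'e set) f g. open S \<Longrightarrow> smooth_on S f \<Longrightarrow> smooth_on S g \<Longrightarrow>
      smooth_on S (\<lambda>y. op (f y) (g y))"
  shows "smooth_near p (\<lambda>q. op (f q) (g q))"
proof -
  from f obtain W1 where W1: "open W1" "p \<in> W1"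
    "\<And>U \<phi>. (U, \<phi>) \<in> A \<Longrightarrow> smooth_on (\<phi> ` (U \<inter> W1)) (\<lambda>y. f (inv_into U \<phi> y))"
    unfolding smooth_near_def by blast
  from g obtain W2 where W2: "open W2" "p \<in> W2"
    "\<And>U \<phi>. (U, \<phi>) \<in> A \<Longrightarrow> smooth_on (\<phi> ` (U \<inter> W2)) (\<lambda>y. g (inv_into U \<phi> y))"
    unfolding smooth_near_def by blast
  show ?thesis
  proof (rule smooth_near_on)
    show W: "open (W1 \<inter> W2)" using W1(1) W2(1) by blast
    show "p \<in> W1 \<inter> W2" using W1(2) W2(2) by blast
    fix U \<phi> assume c: "(U, \<phi>) \<in> A"
    show "smooth_on (\<phi> ` (U \<inter> (W1 \<inter> W2))) (\<lambda>y. op (f (inv_into U \<phi> y)) (g (inv_into U \<phi> y)))"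
      by (rule op[OF chart_image_open[OF c W] smooth_on_subset[OF W1(3)[OF c]]
            smooth_on_subset[OF W2(3)[OF c]]]) auto
  qed
qed

lemma smooth_near_const: "smooth_near p (\<lambda>q. c)"
  by (rule smooth_near_on[OF open_UNIV UNIV_I smooth_on_const])

lemma smooth_near_add: "smooth_near p f \<Longrightarrow> smooth_near p g \<Longrightarrow> smooth_near p (\<lambda>q. f q + g q)"
  by (rule smooth_near_binary[OF _ _ smooth_on_add])

lemma smooth_near_mult: "smooth_near p f \<Longrightarrow> smooth_near p g \<Longrightarrow> smooth_near p (\<lambda>q. f q * g q)"
  by (rule smooth_near_binary[OF _ _ smooth_on_mult])

lemma smooth_near_diff:
  assumes "smooth_near p f" "smooth_near p g"
  shows "smooth_near p (\<lambda>q. f q - g q)"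
  using smooth_near_add[OF assms(1) smooth_near_mult[OF smooth_near_const assms(2), of "-1"]] by simp

lemma smooth_near_sum:
  "(\<And>i. i \<in> I \<Longrightarrow> smooth_near p (f i)) \<Longrightarrow> smooth_near p (\<lambda>q. \<Sum>i\<in>I. f i q)"
proof (induction I rule: infinite_finite_induct)
  case (insert i I)
  then show ?case by (simp add: smooth_near_add)
qed (simp_all add: smooth_near_const)

lemma smooth_near_isCont:
  assumes "smooth_near p f"
  shows "isCont f p"
proof -
  obtain W where W: "open W" "p \<in> W"
    "\<And>U \<phi>. (U, \<phi>) \<in> A \<Longrightarrow> smooth_on (\<phi> ` (U \<inter> W)) (\<lambda>y. f (inv_into U \<phi> y))"
    using assms unfolding smooth_near_def by blast
  obtain U \<phi> where c: "(U, \<phi>) \<in> A" "p \<in> U" using ex_chart by blast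
  have f: "continuous_on (\<phi> ` (U \<inter> W)) (\<lambda>y. f (inv_into U \<phi> y))"
    using W(3)[OF c(1)] unfolding smooth_on_def by (metis Ck_on.simps(1))
  have "continuous_on (U \<inter> W) \<phi>"
    by (rule continuous_on_subset[OF chart_continuous(1)[OF c(1)]]) blast
  from continuous_on_compose2[OF f this subset_refl]
  have "continuous_on (U \<inter> W) (\<lambda>q. f (inv_into U \<phi> (\<phi> q)))" .
  then have "continuous_on (U \<inter> W) f"
    by (rule continuous_on_eq) (simp add: chart_inv[OF c(1)])
  moreover have "open (U \<inter> W)" "p \<in> U \<inter> W"
    using W(1,2) c(2) chart_homeomorphism(1)[OF c(1)] by auto
  ultimately show ?thesis by (simp add: continuous_on_eq_continuous_at)
qed

lemma smooth_near_nonzero_open: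
  assumes "smooth_near p f" "f p \<noteq> 0"
  shows "\<exists>W. open W \<and> p \<in> W \<and> (\<forall>q\<in>W. f q \<noteq> 0)"
proof -
  have "\<forall>\<^sub>F q in nhds p. f q \<noteq> 0"
    using tendsto_imp_eventually_ne[of f "f p" "nhds p" 0] smooth_near_isCont[OF assms(1)] assms(2)
    by (simp add: continuous_at tendsto_at_iff_tendsto_nhds)
  then show ?thesis unfolding eventually_nhds by blast
qed

lemma smooth_near_cong:
  assumes "smooth_near p f" "open V" "p \<in> V" "\<And>q. q \<in> V \<Longrightarrow> f q = g q"
  shows "smooth_near p g"
proof -
  obtain W where W: "open W" "p \<in> W"
    "\<And>U \<phi>. (U, \<phi>) \<in> A \<Longrightarrow> smooth_on (\<phi> ` (U \<inter> W)) (\<lambda>y. f (inv_into U \<phi> y))"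
    using assms(1) unfolding smooth_near_def by blast
  show ?thesis
  proof (rule smooth_near_on)
    show VW: "open (V \<inter> W)" using W(1) assms(2) by blast
    show "p \<in> V \<inter> W" using W(2) assms(3) by blast
    fix U \<phi> assume c: "(U, \<phi>) \<in> A"
    have "smooth_on (\<phi> ` (U \<inter> (V \<inter> W))) (\<lambda>y. f (inv_into U \<phi> y))"
      by (rule smooth_on_subset[OF W(3)[OF c]]) auto
    then show "smooth_on (\<phi> ` (U \<inter> (V \<inter> W))) (\<lambda>y. g (inv_into U \<phi> y))"
      by (rule smooth_on_cong[OF chart_image_open[OF c VW]]) (use assms(4) chart_inv[OF c] in auto)
  qed
qed

lemma smooth_near_inverse:
  assumes "smooth_near p f" "f p \<noteq> 0"
  shows "smooth_near p (\<lambda>q. inverse (f q))"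
proof -
  obtain V where V: "open V" "p \<in> V" "\<forall>q\<in>V. f q \<noteq> 0"
    using smooth_near_nonzero_open[OF assms] by blast
  obtain W where W: "open W" "p \<in> W"
    "\<And>U \<phi>. (U, \<phi>) \<in> A \<Longrightarrow> smooth_on (\<phi> ` (U \<inter> W)) (\<lambda>y. f (inv_into U \<phi> y))"
    using assms(1) unfolding smooth_near_def by blast
  show ?thesis
  proof (rule smooth_near_on)
    show VW: "open (V \<inter> W)" using W(1) V(1) by blast
    show "p \<in> V \<inter> W" using W(2) V(2) by blast
    fix U \<phi> assume c: "(U, \<phi>) \<in> A"
    have "smooth_on (\<phi> ` (U \<inter> (V \<inter> W))) (\<lambda>y. f (inv_into U \<phi> y))"
      by (rule smooth_on_subset[OF W(3)[OF c]]) auto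
    then show "smooth_on (\<phi> ` (U \<inter> (V \<inter> W))) (\<lambda>y. inverse (f (inv_into U \<phi> y)))"
      by (rule smooth_on_inverse[OF chart_image_open[OF c VW]]) (use V(3) chart_inv[OF c] in auto)
  qed
qed

lemma smooth_const: "(\<lambda>q. c) \<in> C"
  by (simp add: smooth_functions_iff smooth_near_const)

lemma smooth_add: "f \<in> C \<Longrightarrow> g \<in> C \<Longrightarrow> (\<lambda>q. f q + g q) \<in> C"
  by (simp add: smooth_functions_iff smooth_near_add)

lemma smooth_diff: "f \<in> C \<Longrightarrow> g \<in> C \<Longrightarrow> (\<lambda>q. f q - g q) \<in> C"
  by (simp add: smooth_functions_iff smooth_near_diff)

lemma smooth_mult: "f \<in> C \<Longrightarrow> g \<in> C \<Longrightarrow> (\<lambda>q. f q * g q) \<in> C"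
  by (simp add: smooth_functions_iff smooth_near_mult)

lemma smooth_sum: "(\<And>i. i \<in> I \<Longrightarrow> f i \<in> C) \<Longrightarrow> (\<lambda>q. \<Sum>i\<in>I. f i q) \<in> C"
  by (simp add: smooth_functions_iff smooth_near_sum)

text \<open>Extension by zero. Near a point of the chart over \<open>S\<close> the function is a
  composite with a transition map, smooth by compatibility; near every other point it vanishes
  identically.\<close>

lemma smooth_chart_extension:
  assumes c: "(U, \<phi>) \<in> A" and S: "open S" "S \<subseteq> \<phi> ` U" and K: "compact K" "K \<subseteq> S"
    and u: "smooth_on S u" "\<And>y. y \<in> S \<Longrightarrow> y \<notin> K \<Longrightarrow> u y = 0"
  shows "(\<lambda>q. if q \<in> U \<and> \<phi> q \<in> S then u (\<phi> q) else 0) \<in> C" (is "?f \<in> C")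
  unfolding smooth_functions_iff
proof
  fix p
  note h = chart_homeomorphism[OF c]
  show "smooth_near p ?f"
  proof (cases "p \<in> U \<and> \<phi> p \<in> S")
    case True
    show ?thesis
    proof (rule smooth_near_on)
      let ?W = "{q \<in> U. \<phi> q \<in> S}"
      show W: "open ?W" using chart_preimage_open[OF c S(1)] .
      show "p \<in> ?W" using True by blast
      fix V \<psi> assume d: "(V, \<psi>) \<in> A"
      have o: "open (\<psi> ` (V \<inter> ?W))" using chart_image_open[OF d W] .
      have "smooth_on (\<psi> ` (V \<inter> U)) (\<phi> \<circ> inv_into V \<psi>)"
        using atlas c d unfolding smooth_atlas_def compatible_def by fastforce
      then have "smooth_on (\<psi> ` (V \<inter> ?W)) (\<phi> \<circ> inv_into V \<psi>)"
        by (rule smooth_on_subset) auto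
      then have "smooth_on (\<psi> ` (V \<inter> ?W)) (\<lambda>y. u ((\<phi> \<circ> inv_into V \<psi>) y))"
        by (rule smooth_on_compose[OF o S(1) _ _ u(1), rotated]) (use chart_inv[OF d] in auto)
      then show "smooth_on (\<psi> ` (V \<inter> ?W)) (\<lambda>y. ?f (inv_into V \<psi> y))"
        by (rule smooth_on_cong[OF o]) (use chart_inv[OF d] in auto)
    qed
  next
    case False
    let ?K = "inv_into U \<phi> ` K"
    have "continuous_on K (inv_into U \<phi>)"
      by (rule continuous_on_subset[OF chart_continuous(2)[OF c]]) (use K(2) S(2) in blast)
    \<comment> \<open>The part of the manifold over the compact \<open>K\<close> is compact, hence
      closed since the manifold is Hausdorff; so \<open>p\<close> has a neighbourhood that avoids
      it.\<close>
    then have K': "open (- ?K)"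
      using K(1) compact_continuous_image compact_imp_closed by blast
    have p: "p \<in> - ?K"
    proof
      assume "p \<in> ?K"
      then obtain y where y: "y \<in> K" "p = inv_into U \<phi> y" by blast
      then have "y \<in> \<phi> ` U" using K(2) S(2) by blast
      then have "p \<in> U" "\<phi> p = y" using y(2) f_inv_into_f inv_into_into by metis+
      then show False using False y(1) K(2) by blast
    qed
    show ?thesis
    proof (rule smooth_near_cong[OF smooth_near_const K' p])
      show "0 = ?f q" if "q \<in> - ?K" for q
      proof -
        have "\<phi> q \<notin> K" if "q \<in> U" using that \<open>q \<in> - ?K\<close> chart_inv[OF c that] by force
        then show ?thesis using u(2) by auto
      qed
    qed
  qed
qed

end

section \<open>Tangent vectors and local frames\<close>

context manifold
begin

section \<open>Algebra of derivations at a point\<close>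

lemma tangent_iff:
  "v \<in> TM p \<longleftrightarrow>
     (\<forall>f\<in>C. \<forall>g\<in>C. v (\<lambda>q. f q + g q) = v f + v g) \<and>
     (\<forall>c. \<forall>f\<in>C. v (\<lambda>q. c * f q) = c * v f) \<and>
     (\<forall>f\<in>C. \<forall>g\<in>C. v (\<lambda>q. f q * g q) = f p * v g + g p * v f) \<and>
     (\<forall>f. f \<notin> C \<longrightarrow> v f = 0)"
  unfolding tangent_space_def scl_def plus_fun_def times_fun_def by simp

lemma tangent_add: "v \<in> TM p \<Longrightarrow> f \<in> C \<Longrightarrow> g \<in> C \<Longrightarrow> v (\<lambda>q. f q + g q) = v f + v g"
  and tangent_scale: "v \<in> TM p \<Longrightarrow> f \<in> C \<Longrightarrow> v (\<lambda>q. c * f q) = c * v f"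
  and tangent_mult: "v \<in> TM p \<Longrightarrow> f \<in> C \<Longrightarrow> g \<in> C \<Longrightarrow>
    v (\<lambda>q. f q * g q) = f p * v g + g p * v f"
  and tangent_outside: "v \<in> TM p \<Longrightarrow> f \<notin> C \<Longrightarrow> v f = 0"
  unfolding tangent_iff by blast+

text \<open>The Leibniz rule for 1 = 1 * 1 gives v(1) = 2 v(1).\<close>

lemma tangent_const:
  assumes v: "v \<in> TM p"
  shows "v (\<lambda>q. c) = 0"
proof -
  have "v (\<lambda>q. 1) = 0" using tangent_mult[OF v smooth_const smooth_const, of 1 1] by simp
  then show ?thesis using tangent_scale[OF v smooth_const, of c 1] by simp
qed

lemma tangent_diff:
  assumes "v \<in> TM p" "f \<in> C" "g \<in> C"
  shows "v (\<lambda>q. f q - g q) = v f - v g"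
  using tangent_add[OF assms(1,2) smooth_mult[OF smooth_const assms(3), of "-1"]]
    tangent_scale[OF assms(1,3), of "-1"] by simp

lemma tangent_sum:
  assumes v: "v \<in> TM p" and "\<And>i. i \<in> I \<Longrightarrow> f i \<in> C"
  shows "v (\<lambda>q. \<Sum>i\<in>I. f i q) = (\<Sum>i\<in>I. v (f i))"
  using assms(2)
proof (induction I rule: infinite_finite_induct)
  case (insert i I)
  then have "v (\<lambda>q. f i q + (\<Sum>i\<in>I. f i q)) = v (f i) + v (\<lambda>q. \<Sum>i\<in>I. f i q)"
    by (intro tangent_add[OF v] smooth_sum) auto
  then show ?case using insert by simp
qed (simp_all add: tangent_const[OF v])

lemma zero_tangent: "(\<lambda>f. 0) \<in> TM p"
  unfolding tangent_iff by simp

lemma tangent_plus: "v \<in> TM p \<Longrightarrow> w \<in> TM p \<Longrightarrow> v + w \<in> TM p"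
  unfolding tangent_iff by (simp add: algebra_simps)

lemma tangent_scl: "v \<in> TM p \<Longrightarrow> scl c v \<in> TM p"
  unfolding tangent_iff scl_def by (simp add: algebra_simps)

lemma tangent_linear_combination:
  assumes "\<And>i. i \<in> I \<Longrightarrow> v i \<in> TM p"
  shows "(\<lambda>f. \<Sum>i\<in>I. c i * v i f) \<in> TM p"
  using assms
proof (induction I rule: infinite_finite_induct)
  case (insert i I)
  then have "scl (c i) (v i) + (\<lambda>f. \<Sum>i\<in>I. c i * v i f) \<in> TM p"
    by (intro tangent_plus tangent_scl) auto
  moreover have "scl (c i) (v i) + (\<lambda>f. \<Sum>i\<in>I. c i * v i f) = (\<lambda>f. \<Sum>i\<in>insert i I. c i * v i f)"
    using insert by (simp add: fun_eq_iff scl_def)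
  ultimately show ?case by simp
qed (simp_all add: zero_tangent)

text \<open>The coordinate vector at \<open>q\<close> in direction \<open>b\<close>. The value 0 off
  \<open>C\<close> is the convention of \<open>tangent_space\<close>.\<close>

definition chart_deriv :: "('m, 'e) chart \<Rightarrow> 'e \<Rightarrow> 'm \<Rightarrow> 'm tvec" where
  "chart_deriv = (\<lambda>(U, \<phi>) b q f.
     if f \<in> C then frechet_derivative (f \<circ> inv_into U \<phi>) (at (\<phi> q)) b else 0)"

lemma smooth_in_chart: "(U, \<phi>) \<in> A \<Longrightarrow> f \<in> C \<Longrightarrow> smooth_on (\<phi> ` U) (f \<circ> inv_into U \<phi>)"
  unfolding smooth_functions_def by blast

lemma chart_has_derivative:
  assumes "(U, \<phi>) \<in> A" "f \<in> C" "q \<in> U"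
  shows "(f \<circ> inv_into U \<phi> has_derivative (\<lambda>b. chart_deriv (U, \<phi>) b q f)) (at (\<phi> q))"
  using smooth_on_has_derivative[OF chart_homeomorphism(2) smooth_in_chart] assms
  by (simp add: chart_deriv_def)

lemma chart_deriv_unique:
  assumes "(U, \<phi>) \<in> A" "f \<in> C" "q \<in> U" "(f \<circ> inv_into U \<phi> has_derivative f') (at (\<phi> q))"
  shows "chart_deriv (U, \<phi>) b q f = f' b"
  using has_derivative_unique[OF chart_has_derivative[OF assms(1-3)] assms(4)] by (rule fun_cong)

lemma chart_deriv_tangent:
  assumes c: "(U, \<phi>) \<in> A" and q: "q \<in> U"
  shows "chart_deriv (U, \<phi>) b q \<in> TM q"
  unfolding tangent_iff
proof (intro conjI ballI allI impI)
  note d = chart_has_derivative[OF c _ q, unfolded o_def]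
  note u = chart_deriv_unique[OF c _ q, unfolded o_def]
  fix f g assume f: "f \<in> C" and g: "g \<in> C"
  show "chart_deriv (U, \<phi>) b q (\<lambda>q. f q + g q) = chart_deriv (U, \<phi>) b q f + chart_deriv (U, \<phi>) b q g"
    by (rule u[OF smooth_add[OF f g] has_derivative_add[OF d[OF f] d[OF g]]])
  show "chart_deriv (U, \<phi>) b q (\<lambda>q. f q * g q) =
      f q * chart_deriv (U, \<phi>) b q g + g q * chart_deriv (U, \<phi>) b q f"
    using u[OF smooth_mult[OF f g] has_derivative_mult[OF d[OF f] d[OF g]], of b]
    by (simp add: chart_inv[OF c q])
next
  fix c' f assume f: "f \<in> C"
  show "chart_deriv (U, \<phi>) b q (\<lambda>q. c' * f q) = c' * chart_deriv (U, \<phi>) b q f"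
    by (rule chart_deriv_unique[OF c smooth_mult[OF smooth_const f] q, unfolded o_def,
          OF has_derivative_mult_right[OF chart_has_derivative[OF c f q, unfolded o_def]]])
qed (simp add: chart_deriv_def)

text \<open>Hadamard's factors live only on a ball, so a cut-off turns them into global functions to
  which \<open>v\<close> applies. The \<open>x b\<close> are given in advance and agree with the
  coordinates only near \<open>q\<close>; thus \<open>local_frame\<close> can use one family
  \<open>x\<close> for all base points \<open>q\<close>.\<close>

lemma tangent_coordinates:
  assumes c: "(U, \<phi>) \<in> A" and q: "q \<in> U" and r: "0 < r" "ball (\<phi> q) r \<subseteq> \<phi> ` U"
    and x: "\<And>b. x b \<in> C" "\<And>b q'. q' \<in> U \<Longrightarrow> \<phi> q' \<in> ball (\<phi> q) r \<Longrightarrow> x b q' = \<phi> q' \<bullet> b"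
    and f: "f \<in> C" and v: "v \<in> TM q"
  shows "v f = (\<Sum>b\<in>Basis. v (x b) * chart_deriv (U, \<phi>) b q f)"
proof -
  \<comment> \<open>Half the radius leaves room for a compact set that contains the support of the
    cut-off, as extension by zero requires.\<close>
  let ?S = "ball (\<phi> q) r" and ?K = "cball (\<phi> q) (r / 2)"
  let ?f = "f \<circ> inv_into U \<phi>" and ?in = "\<lambda>q'. q' \<in> U \<and> \<phi> q' \<in> ball (\<phi> q) r"
  have K: "compact ?K" "?K \<subseteq> ?S" using r(1) by auto
  obtain g where g: "\<And>b. smooth_on ?S (g b)" "\<And>b. g b (\<phi> q) = frechet_derivative ?f (at (\<phi> q)) b"
    "\<And>y. y \<in> ?S \<Longrightarrow> ?f y = ?f (\<phi> q) + (\<Sum>b\<in>Basis. ((y - \<phi> q) \<bullet> b) * g b y)"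
    by (rule hadamard[OF smooth_on_subset[OF smooth_in_chart[OF c f] r(2)] r(1)]) (rule that)
  obtain \<beta> where \<beta>: "smooth_on UNIV \<beta>" "\<beta> (\<phi> q) = (1::real)" "\<And>y. y \<notin> ball (\<phi> q) (r / 2) \<Longrightarrow> \<beta> y = 0"
    by (rule bump_function[OF half_gt_zero[OF r(1)]]) (rule that)
  have \<beta>0: "\<beta> y = 0" if "y \<notin> ?K" for y using that ball_subset_cball \<beta>(3) by blast
  have \<beta>S: "smooth_on ?S \<beta>" by (rule smooth_on_subset[OF \<beta>(1)]) simp
  define B where "B q' = (if ?in q' then \<beta> (\<phi> q') else 0)" for q'
  define G where "G b q' = (if ?in q' then \<beta> (\<phi> q') * g b (\<phi> q') else 0)" for b q'
  have B: "B \<in> C"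
    unfolding B_def by (rule smooth_chart_extension[OF c open_ball r(2) K \<beta>S \<beta>0])
  have G: "G b \<in> C" for b
    unfolding G_def
    by (rule smooth_chart_extension[OF c open_ball r(2) K, where u = "\<lambda>y. \<beta> y * g b y"])
      (use smooth_on_mult[OF open_ball \<beta>S g(1)] \<beta>0 in auto)
  have q': "?in q" using q r(1) by simp
  have Bq: "B q = 1" using q' \<beta>(2) by (simp add: B_def)
  have Gq: "G b q = chart_deriv (U, \<phi>) b q f" for b
    using q' \<beta>(2) g(2) f by (simp add: G_def chart_deriv_def)
  have BB: "(\<lambda>q. B q * B q) \<in> C" by (intro smooth_mult B)
  have xa: "(\<lambda>q'. x b q' - \<phi> q \<bullet> b) \<in> C" for b by (intro smooth_diff x(1) smooth_const)
  \<comment> \<open>Hadamard's identity times \<open>\<beta>\<^sup>2\<close>, which makes it an identity between global functions.\<close>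
  have "(\<lambda>q'. (B q' * B q') * f q') =
      (\<lambda>q'. f q * (B q' * B q') + (\<Sum>b\<in>Basis. (B q' * (x b q' - \<phi> q \<bullet> b)) * G b q'))"
  proof
    fix p
    show "(B p * B p) * f p = f q * (B p * B p) + (\<Sum>b\<in>Basis. (B p * (x b p - \<phi> q \<bullet> b)) * G b p)"
    proof (cases "?in p")
      case True
      have "f p = f q + (\<Sum>b\<in>Basis. ((\<phi> p - \<phi> q) \<bullet> b) * g b (\<phi> p))"
        using g(3)[of "\<phi> p"] True chart_inv[OF c] q by simp
      moreover have "(\<Sum>b\<in>Basis. (B p * (x b p - \<phi> q \<bullet> b)) * G b p) =
          B p * B p * (\<Sum>b\<in>Basis. ((\<phi> p - \<phi> q) \<bullet> b) * g b (\<phi> p))"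
        using True x(2)[of p] by (simp add: sum_distrib_left B_def G_def inner_diff_left mult_ac)
      ultimately show ?thesis by (simp add: algebra_simps)
    next
      case False
      then have "B p = 0" by (auto simp: B_def)
      then show ?thesis by simp
    qed
  qed
  then have "v (\<lambda>q'. (B q' * B q') * f q') = v \<dots>" by simp
  also have "\<dots> = v (\<lambda>q'. f q * (B q' * B q')) +
      v (\<lambda>q'. \<Sum>b\<in>Basis. (B q' * (x b q' - \<phi> q \<bullet> b)) * G b q')"
    by (intro tangent_add[OF v] smooth_sum smooth_mult smooth_const xa B G)
  also have "v (\<lambda>q'. f q * (B q' * B q')) = f q * v (\<lambda>q'. B q' * B q')"
    by (rule tangent_scale[OF v BB])
  also have "v (\<lambda>q'. \<Sum>b\<in>Basis. (B q' * (x b q' - \<phi> q \<bullet> b)) * G b q') =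
      (\<Sum>b\<in>Basis. v (\<lambda>q'. (B q' * (x b q' - \<phi> q \<bullet> b)) * G b q'))"
    by (intro tangent_sum[OF v] smooth_mult xa B G)
  \<comment> \<open>The factor \<open>x b - \<phi> q \<bullet> b\<close> vanishes at
    \<open>q\<close>, so by the Leibniz rule only its derivative times \<open>G b q\<close>
    survives.\<close>
  also have "\<dots> = (\<Sum>b\<in>Basis. v (x b) * chart_deriv (U, \<phi>) b q f)"
  proof (rule sum.cong[OF refl])
    fix b
    have "v (\<lambda>q'. (B q' * (x b q' - \<phi> q \<bullet> b)) * G b q') =
        B q * (x b q - \<phi> q \<bullet> b) * v (G b) + G b q * v (\<lambda>q'. B q' * (x b q' - \<phi> q \<bullet> b))"
      by (rule tangent_mult[OF v smooth_mult[OF B xa] G])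
    also have "v (\<lambda>q'. B q' * (x b q' - \<phi> q \<bullet> b)) =
        B q * v (\<lambda>q'. x b q' - \<phi> q \<bullet> b) + (x b q - \<phi> q \<bullet> b) * v B"
      by (rule tangent_mult[OF v B xa])
    also have "v (\<lambda>q'. x b q' - \<phi> q \<bullet> b) = v (x b)"
      using tangent_diff[OF v x(1) smooth_const] tangent_const[OF v] by simp
    also have "x b q = \<phi> q \<bullet> b" using x(2) q' by blast
    finally show "v (\<lambda>q'. (B q' * (x b q' - \<phi> q \<bullet> b)) * G b q') = v (x b) * chart_deriv (U, \<phi>) b q f"
      by (simp add: Bq Gq)
  qed
  finally have "v (\<lambda>q'. (B q' * B q') * f q') = f q * v (\<lambda>q'. B q' * B q') +
      (\<Sum>b\<in>Basis. v (x b) * chart_deriv (U, \<phi>) b q f)" .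
  \<comment> \<open>As \<open>B q = 1\<close>, the Leibniz rule on the left gives v f plus f(q)
    times the derivative of B * B; the latter term also stands on the right and cancels.\<close>
  then show ?thesis using tangent_mult[OF v BB f] by (simp add: Bq)
qed

text \<open>On the chart \<open>E b\<close> is \<open>\<psi>\<close> times a coordinate field, and
  \<open>x b\<close> is a coordinate times a plateau that equals 1 wherever \<open>\<psi>\<close> is
  nonzero. There the identity is \<open>tangent_coordinates\<close>; elsewhere both sides vanish.
  The duality relations at \<open>p\<close> serve to read off coefficients.\<close>

lemma local_frame:
  obtains \<psi> x E where
    "\<psi> \<in> C" "\<And>b. x b \<in> C" "\<And>b. E b \<in> VM" "\<psi> p = 1"
    "\<And>b b'. b \<in> Basis \<Longrightarrow> b' \<in> Basis \<Longrightarrow> E b p (x b') = (if b = b' then 1 else 0)"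
    "\<And>q v. v \<in> TM q \<Longrightarrow> scl (\<psi> q) v = (\<lambda>f. \<Sum>b\<in>(Basis :: 'e set). v (x b) * E b q f)"
proof -
  obtain U \<phi> where c: "(U, \<phi>) \<in> A" and p: "p \<in> U" using ex_chart by blast
  let ?a = "\<phi> p"
  obtain R where R: "0 < R" "cball ?a R \<subseteq> \<phi> ` U"
    using open_contains_cball chart_homeomorphism(2)[OF c] p by blast
  \<comment> \<open>Two radii: \<open>\<psi>\<close> lives inside radius \<open>r\<close>, while the
    coordinates are cut off only between \<open>r\<close> and \<open>R\<close>.\<close>
  define r where "r = R / 2"
  have r: "0 < r" "r < R" using R(1) by (auto simp: r_def)
  have K: "compact (cball ?a R)" "compact (cball ?a r)" "cball ?a r \<subseteq> \<phi> ` U"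
    using R(2) r by auto
  obtain \<beta> where \<beta>: "smooth_on UNIV \<beta>" "\<beta> ?a = (1::real)" "\<And>y. y \<notin> ball ?a r \<Longrightarrow> \<beta> y = 0"
    by (rule bump_function[OF r(1)]) (rule that)
  obtain \<kappa> where \<kappa>: "smooth_on UNIV \<kappa>" "\<And>y. y \<in> cball ?a r \<Longrightarrow> \<kappa> y = (1::real)"
    "\<And>y. y \<notin> ball ?a R \<Longrightarrow> \<kappa> y = 0"
    by (rule plateau_function[OF r]) (rule that)
  have \<beta>0: "\<beta> y = 0" if "y \<notin> cball ?a r" for y using that ball_subset_cball \<beta>(3) by blast
  have \<kappa>0: "\<kappa> y = 0" if "y \<notin> cball ?a R" for y using that ball_subset_cball \<kappa>(3) by blast
  note o = chart_homeomorphism(2)[OF c]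
  have \<beta>S: "smooth_on (\<phi> ` U) \<beta>" by (rule smooth_on_subset[OF \<beta>(1)]) simp
  have \<kappa>S: "smooth_on (\<phi> ` U) \<kappa>" by (rule smooth_on_subset[OF \<kappa>(1)]) simp
  \<comment> \<open>The condition on \<open>\<phi> q\<close> gives these functions the shape that
    \<open>smooth_chart_extension\<close> yields when its \<open>S\<close> is the whole image of
    \<open>U\<close>.\<close>
  define \<psi> where "\<psi> q = (if q \<in> U \<and> \<phi> q \<in> \<phi> ` U then \<beta> (\<phi> q) else 0)" for q
  define x where "x b q = (if q \<in> U \<and> \<phi> q \<in> \<phi> ` U then \<kappa> (\<phi> q) * (\<phi> q \<bullet> b) else 0)" for b q
  define E where "E b q = scl (\<psi> q) (if q \<in> U then chart_deriv (U, \<phi>) b q else (\<lambda>f. 0))" for b q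
  have \<psi>: "\<psi> \<in> C"
    unfolding \<psi>_def by (rule smooth_chart_extension[OF c o subset_refl K(2,3) \<beta>S \<beta>0])
  have x: "x b \<in> C" for b
    unfolding x_def
    by (rule smooth_chart_extension[OF c o subset_refl K(1) R(2), where u = "\<lambda>y. \<kappa> y * (y \<bullet> b)"])
      (use smooth_on_mult[OF o \<kappa>S smooth_on_bounded_linear[OF o bounded_linear_inner_left smooth_on_ident[OF o]]]
        \<kappa>0 in auto)
  have xU: "x b q = \<phi> q \<bullet> b" if "q \<in> U" "\<phi> q \<in> ball ?a r" for b q
    using that \<kappa>(2)[of "\<phi> q"] by (simp add: x_def)
  have E: "E b \<in> VM" for b
    unfolding vector_fields_def
  proof (intro CollectI conjI allI ballI)
    show "E b q \<in> TM q" for q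
      unfolding E_def using chart_deriv_tangent[OF c] zero_tangent by (intro tangent_scl) auto
    fix f assume f: "f \<in> C"
    let ?u = "\<lambda>y. \<beta> y * frechet_derivative (f \<circ> inv_into U \<phi>) (at y) b"
    have "smooth_on (\<phi> ` U) ?u"
      by (rule smooth_on_mult[OF o \<beta>S smooth_on_deriv[OF smooth_in_chart[OF c f]]])
    then have "(\<lambda>q. if q \<in> U \<and> \<phi> q \<in> \<phi> ` U then ?u (\<phi> q) else 0) \<in> C"
      by (rule smooth_chart_extension[OF c o subset_refl K(2,3)]) (use \<beta>0 in auto)
    moreover have "(\<lambda>q. if q \<in> U \<and> \<phi> q \<in> \<phi> ` U then ?u (\<phi> q) else 0) = (\<lambda>q. E b q f)"
      using f by (auto simp: E_def \<psi>_def scl_def chart_deriv_def)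
    ultimately show "(\<lambda>q. E b q f) \<in> C" by simp
  qed
  have \<psi>p: "\<psi> p = 1" using p \<beta>(2) by (simp add: \<psi>_def)
  have dual: "E b p (x b') = (if b = b' then 1 else 0)" if b: "b \<in> Basis" "b' \<in> Basis" for b b'
  proof -
    have "((\<lambda>y. y \<bullet> b') has_derivative (\<lambda>y. y \<bullet> b')) (at ?a)"
      by (rule bounded_linear_imp_has_derivative[OF bounded_linear_inner_left])
    then have "(x b' \<circ> inv_into U \<phi> has_derivative (\<lambda>y. y \<bullet> b')) (at ?a)"
    proof (rule has_derivative_transform_within_open[OF _ open_ball[of ?a r]])
      show "?a \<in> ball ?a r" using r(1) by simp
      fix y assume y: "y \<in> ball ?a r"
      then have "y \<in> \<phi> ` U" using K(3) ball_subset_cball by blast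
      then show "y \<bullet> b' = (x b' \<circ> inv_into U \<phi>) y"
        using y xU chart_inv[OF c] by auto
    qed
    then have "chart_deriv (U, \<phi>) b p (x b') = b \<bullet> b'"
      by (rule chart_deriv_unique[OF c x p])
    then show ?thesis using p b by (simp add: E_def \<psi>p scl_def inner_Basis)
  qed
  have "scl (\<psi> q) v = (\<lambda>f. \<Sum>b\<in>(Basis :: 'e set). v (x b) * E b q f)" if v: "v \<in> TM q" for q v
  proof
    fix f
    show "scl (\<psi> q) v f = (\<Sum>b\<in>(Basis :: 'e set). v (x b) * E b q f)"
    proof (cases "q \<in> U \<and> \<phi> q \<in> ball ?a r \<and> f \<in> C")
      case True
      then obtain s where s: "0 < s" "ball (\<phi> q) s \<subseteq> ball ?a r"
        using open_contains_ball[of "ball ?a r"] by blast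
      have "ball (\<phi> q) s \<subseteq> \<phi> ` U"
        using s(2) K(3) ball_subset_cball[of ?a r] by (metis subset_trans)
      then have "v f = (\<Sum>b\<in>Basis. v (x b) * chart_deriv (U, \<phi>) b q f)"
        using True s(2) by (intro tangent_coordinates[OF c _ s(1) _ x _ _ v] xU) auto
      then show ?thesis using True by (simp add: scl_def E_def sum_distrib_left mult_ac)
    next
      case False
      \<comment> \<open>Away from the ball \<open>\<psi>\<close> vanishes, and a non-smooth
        \<open>f\<close> is sent to 0 by every tangent vector.\<close>
      show ?thesis
      proof (cases "f \<in> C")
        case True
        then have "\<psi> q = 0" using False \<beta>(3) by (auto simp: \<psi>_def)
        then show ?thesis by (simp add: scl_def E_def)
      next
        case False
        then show ?thesis
          using tangent_outside[OF v] by (cases "q \<in> U") (simp_all add: scl_def E_def chart_deriv_def)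
      qed
    qed
  qed
  with \<psi> x E \<psi>p dual show thesis by (rule that)
qed

end

section \<open>Tensorial maps and smooth solutions of linear systems\<close>

context manifold
begin

section \<open>Global vector fields and function-linear maps\<close>

lemma vector_field_tangent: "X \<in> VM \<Longrightarrow> X p \<in> TM p"
  and vector_field_smooth: "X \<in> VM \<Longrightarrow> f \<in> C \<Longrightarrow> (\<lambda>p. X p f) \<in> C"
  unfolding vector_fields_def by blast+

lemma vector_fieldI:
  "(\<And>p. X p \<in> TM p) \<Longrightarrow> (\<And>f. f \<in> C \<Longrightarrow> (\<lambda>p. X p f) \<in> C) \<Longrightarrow> X \<in> VM"
  unfolding vector_fields_def by blast

lemma zero_vector_field: "(\<lambda>p f. 0) \<in> VM"
  by (rule vector_fieldI) (simp_all add: zero_tangent smooth_const)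

lemma vector_field_add: "X \<in> VM \<Longrightarrow> Y \<in> VM \<Longrightarrow> X + Y \<in> VM"
  by (rule vector_fieldI) (simp_all add: vector_field_tangent vector_field_smooth tangent_plus smooth_add)

lemma vector_field_scl: "g \<in> C \<Longrightarrow> X \<in> VM \<Longrightarrow> (\<lambda>p. scl (g p) (X p)) \<in> VM"
  by (rule vector_fieldI)
    (simp_all add: vector_field_tangent tangent_scl, simp add: scl_def smooth_mult vector_field_smooth)

lemma vector_field_linear_combination:
  assumes "\<And>i. i \<in> I \<Longrightarrow> X i \<in> VM" "\<And>i. i \<in> I \<Longrightarrow> c i \<in> C"
  shows "(\<lambda>p f. \<Sum>i\<in>I. c i p * X i p f) \<in> VM"
  using assms
  by (intro vector_fieldI tangent_linear_combination smooth_sum smooth_mult)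
    (simp_all add: vector_field_tangent vector_field_smooth)

text \<open>Freeze the coefficients: the numbers v(x_b) are constant functions, so the frame
  expansion of \<open>v\<close> is itself a global field.\<close>

lemma extend_vector:
  assumes v: "v \<in> TM p"
  obtains X where "X \<in> VM" "X p = v"
proof (rule local_frame[of p])
  fix \<psi> x E
  assume E: "\<And>b. E b \<in> VM" and \<psi>: "\<psi> p = 1"
    and decomp: "\<And>q v. v \<in> TM q \<Longrightarrow> scl (\<psi> q) v = (\<lambda>f. \<Sum>b\<in>(Basis :: 'e set). v (x b) * E b q f)"
  show thesis
  proof (rule that)
    show "(\<lambda>q f. \<Sum>b\<in>(Basis :: 'e set). v (x b) * E b q f) \<in> VM"
      by (intro vector_field_linear_combination E smooth_const)
    show "(\<lambda>f. \<Sum>b\<in>(Basis :: 'e set). v (x b) * E b p f) = v"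
      unfolding decomp[OF v, symmetric] by (simp add: \<psi> scl_def)
  qed
qed

lemma function_linear_sum:
  fixes F :: "('m \<Rightarrow> 'm tvec) \<Rightarrow> 'm \<Rightarrow> real"
  assumes add: "\<And>X Y p. X \<in> VM \<Longrightarrow> Y \<in> VM \<Longrightarrow> F (X + Y) p = F X p + F Y p"
    and scl: "\<And>g X p. g \<in> C \<Longrightarrow> X \<in> VM \<Longrightarrow> F (\<lambda>p. scl (g p) (X p)) p = g p * F X p"
    and "\<And>i. i \<in> I \<Longrightarrow> X i \<in> VM" "\<And>i. i \<in> I \<Longrightarrow> c i \<in> C"
  shows "F (\<lambda>p f. \<Sum>i\<in>I. c i p * X i p f) p = (\<Sum>i\<in>I. c i p * F (X i) p)"
proof -
  have z: "F (\<lambda>p f. 0) p = 0"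
    using scl[OF smooth_const zero_vector_field, of 0 p] by (simp add: scl_def)
  show ?thesis
    using assms(3,4)
  proof (induction I rule: infinite_finite_induct)
    case (insert i I)
    have "(\<lambda>p f. \<Sum>i\<in>insert i I. c i p * X i p f) =
        (\<lambda>p. scl (c i p) (X i p)) + (\<lambda>p f. \<Sum>i\<in>I. c i p * X i p f)"
      using insert.hyps by (simp add: fun_eq_iff scl_def)
    moreover have "F ((\<lambda>p. scl (c i p) (X i p)) + (\<lambda>p f. \<Sum>i\<in>I. c i p * X i p f)) p =
        F (\<lambda>p. scl (c i p) (X i p)) p + F (\<lambda>p f. \<Sum>i\<in>I. c i p * X i p f) p"
      using insert.prems by (intro add vector_field_scl vector_field_linear_combination) auto
    moreover have "F (\<lambda>p. scl (c i p) (X i p)) p = c i p * F (X i) p"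
      using insert.prems by (intro scl) auto
    ultimately show ?case using insert by simp
  qed (simp_all add: z)
qed

text \<open>Since \<open>\<psi> p = 1\<close>, replacing a field Z by \<open>\<psi>Z\<close> does
  not change F at \<open>p\<close>. Expanding \<open>\<psi>Z\<close> in the global frame then gives
  a sum in which Z occurs only through the numbers \<open>Z p (x b)\<close>.\<close>

lemma function_linear_pointwise:
  fixes F :: "('m \<Rightarrow> 'm tvec) \<Rightarrow> 'm \<Rightarrow> real"
  assumes add: "\<And>X Y p. X \<in> VM \<Longrightarrow> Y \<in> VM \<Longrightarrow> F (X + Y) p = F X p + F Y p"
    and scl: "\<And>g X p. g \<in> C \<Longrightarrow> X \<in> VM \<Longrightarrow> F (\<lambda>p. scl (g p) (X p)) p = g p * F X p"
    and XY: "X \<in> VM" "Y \<in> VM" "X p = Y p"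
  shows "F X p = F Y p"
proof (rule local_frame[of p])
  fix \<psi> x E
  assume \<psi>C: "\<psi> \<in> C" and x: "\<And>b. x b \<in> C" and E: "\<And>b. E b \<in> VM" and \<psi>: "\<psi> p = 1"
    and decomp: "\<And>q v. v \<in> TM q \<Longrightarrow> scl (\<psi> q) v = (\<lambda>f. \<Sum>b\<in>(Basis :: 'e set). v (x b) * E b q f)"
  have expand: "F Z p = (\<Sum>b\<in>(Basis :: 'e set). Z p (x b) * F (E b) p)" if Z: "Z \<in> VM" for Z
  proof -
    have "F Z p = F (\<lambda>q. scl (\<psi> q) (Z q)) p"
      using scl[OF \<psi>C Z, of p] \<psi> by simp
    also have "(\<lambda>q. scl (\<psi> q) (Z q)) = (\<lambda>q f. \<Sum>b\<in>(Basis :: 'e set). Z q (x b) * E b q f)"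
      using decomp vector_field_tangent[OF Z] by blast
    also have "F \<dots> p = (\<Sum>b\<in>(Basis :: 'e set). Z p (x b) * F (E b) p)"
      using function_linear_sum[of F "Basis :: 'e set" E "\<lambda>b q. Z q (x b)" p] add scl E
        vector_field_smooth[OF Z x] by blast
    finally show ?thesis .
  qed
  show ?thesis
    unfolding expand[OF XY(1)] expand[OF XY(2)] XY(3) ..
qed

section \<open>Covectors and 1-forms\<close>

lemma cotangent_iff:
  "\<xi> \<in> TM' p \<longleftrightarrow> (\<forall>v\<in>TM p. \<forall>w\<in>TM p. \<xi> (v + w) = \<xi> v + \<xi> w) \<and>
     (\<forall>c. \<forall>v\<in>TM p. \<xi> (scl c v) = c * \<xi> v) \<and> (\<forall>v. v \<notin> TM p \<longrightarrow> \<xi> v = 0)"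
  unfolding cotangent_space_def by simp

lemma cotangent_linear_combination:
  assumes \<xi>: "\<xi> \<in> TM' p" and "\<And>i. i \<in> I \<Longrightarrow> v i \<in> TM p"
  shows "\<xi> (\<lambda>f. \<Sum>i\<in>I. c i * v i f) = (\<Sum>i\<in>I. c i * \<xi> (v i))"
proof -
  have "\<xi> (scl 0 (\<lambda>f. 0)) = 0 * \<xi> (\<lambda>f. 0)"
    using \<xi> zero_tangent unfolding cotangent_iff by blast
  then have z: "\<xi> (\<lambda>f. 0) = 0" by (simp add: scl_def)
  show ?thesis
    using assms(2)
  proof (induction I rule: infinite_finite_induct)
    case (insert i I)
    have "(\<lambda>f. \<Sum>i\<in>insert i I. c i * v i f) = scl (c i) (v i) + (\<lambda>f. \<Sum>i\<in>I. c i * v i f)"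
      using insert.hyps by (simp add: fun_eq_iff scl_def)
    moreover have "scl (c i) (v i) \<in> TM p" "(\<lambda>f. \<Sum>i\<in>I. c i * v i f) \<in> TM p"
      using insert.prems by (auto intro: tangent_scl tangent_linear_combination)
    ultimately show ?case using \<xi> insert unfolding cotangent_iff by simp
  qed (simp_all add: z)
qed

text \<open>The value on \<open>v\<close> is that of \<open>F\<close> on any global field through
  \<open>v\<close>; the chosen field is immaterial by \<open>function_linear_pointwise\<close>. This
  will provide the existence behind the definite description in \<open>cov_form\<close>.\<close>

lemma function_linear_one_form:
  fixes F :: "('m \<Rightarrow> 'm tvec) \<Rightarrow> 'm \<Rightarrow> real"
  assumes add: "\<And>X Y p. X \<in> VM \<Longrightarrow> Y \<in> VM \<Longrightarrow> F (X + Y) p = F X p + F Y p"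
    and scl: "\<And>g X p. g \<in> C \<Longrightarrow> X \<in> VM \<Longrightarrow> F (\<lambda>p. scl (g p) (X p)) p = g p * F X p"
    and smooth: "\<And>X. X \<in> VM \<Longrightarrow> F X \<in> C"
  shows "\<exists>\<gamma>\<in>FM. \<forall>X\<in>VM. \<forall>p. \<gamma> p (X p) = F X p"
proof -
  define \<gamma> where "\<gamma> p v = (if v \<in> TM p then F (SOME X. X \<in> VM \<and> X p = v) p else 0)" for p v
  have \<gamma>: "\<gamma> p (X p) = F X p" if X: "X \<in> VM" for X p
  proof -
    have "(SOME Y. Y \<in> VM \<and> Y p = X p) \<in> VM \<and> (SOME Y. Y \<in> VM \<and> Y p = X p) p = X p"
      by (rule someI[of _ X]) (use X in blast)
    then have "F (SOME Y. Y \<in> VM \<and> Y p = X p) p = F X p"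
      using function_linear_pointwise[of F, OF add scl _ X] by blast
    then show ?thesis using vector_field_tangent[OF X] by (simp add: \<gamma>_def)
  qed
  have "\<gamma> p \<in> TM' p" for p
    unfolding cotangent_iff
  proof (intro conjI ballI allI impI)
    fix v w assume "v \<in> TM p" "w \<in> TM p"
    then obtain X Y where XY: "X \<in> VM" "X p = v" "Y \<in> VM" "Y p = w"
      using extend_vector by metis
    show "\<gamma> p (v + w) = \<gamma> p v + \<gamma> p w"
      using \<gamma>[OF vector_field_add[OF XY(1,3)], of p] \<gamma>[OF XY(1), of p] \<gamma>[OF XY(3), of p]
        add[OF XY(1,3), of p] XY by simp
  next
    fix c v assume "v \<in> TM p"
    then obtain X where X: "X \<in> VM" "X p = v"
      using extend_vector by metis
    show "\<gamma> p (scl c v) = c * \<gamma> p v"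
      using \<gamma>[OF vector_field_scl[OF smooth_const X(1)], of p c] \<gamma>[OF X(1), of p]
        scl[OF smooth_const X(1), of c p] X by simp
  qed (simp add: \<gamma>_def)
  then have "\<gamma> \<in> FM"
    using smooth \<gamma> unfolding one_forms_def by simp
  then show ?thesis using \<gamma> by blast
qed

lemma cotangent_eqI:
  assumes "\<xi> \<in> TM' p" "\<eta> \<in> TM' p" "\<And>v. v \<in> TM p \<Longrightarrow> \<xi> v = \<eta> v"
  shows "\<xi> = \<eta>"
proof
  show "\<xi> v = \<eta> v" for v
    using assms unfolding cotangent_iff by (cases "v \<in> TM p") simp_all
qed

lemma one_form_cotangent: "\<alpha> \<in> FM \<Longrightarrow> \<alpha> p \<in> TM' p"
  and one_form_smooth: "\<alpha> \<in> FM \<Longrightarrow> X \<in> VM \<Longrightarrow> (\<lambda>p. \<alpha> p (X p)) \<in> C"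
  unfolding one_forms_def by blast+

lemma cotangent_eqI_fields:
  assumes "\<xi> \<in> TM' p" "\<eta> \<in> TM' p" "\<And>X. X \<in> VM \<Longrightarrow> \<xi> (X p) = \<eta> (X p)"
  shows "\<xi> = \<eta>"
proof (rule cotangent_eqI[OF assms(1,2)])
  fix v assume "v \<in> TM p"
  then obtain X where "X \<in> VM" "X p = v" by (rule extend_vector)
  then show "\<xi> v = \<eta> v" using assms(3) by blast
qed

text \<open>
  Gaussian elimination of the unknown \<open>k\<close>. Invertibility enters only as a trivial left kernel of the
  coefficients at the single point \<open>p\<close>, and the index sets need not be related, so no determinants occur.
\<close>
lemma smooth_near_solution:
  assumes "finite I" "open W" "p \<in> W"
    and "\<And>i j. i \<in> I \<Longrightarrow> j \<in> J \<Longrightarrow> smooth_near p (H i j)"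
    and "\<And>j. j \<in> J \<Longrightarrow> smooth_near p (a j)"
    and "\<And>j q. j \<in> J \<Longrightarrow> q \<in> W \<Longrightarrow> (\<Sum>i\<in>I. c i q * H i j q) = a j q"
    and "\<And>u. (\<And>j. j \<in> J \<Longrightarrow> (\<Sum>i\<in>I. u i * H i j p) = 0) \<Longrightarrow> \<forall>i\<in>I. u i = 0"
    and "i \<in> I"
  shows "smooth_near p (c i)"
  using assms
proof (induction I arbitrary: W H a i rule: finite_induct)
  case (insert k I)
  note ki = \<open>k \<notin> I\<close> and fin = \<open>finite I\<close>
  note W = \<open>open W\<close> \<open>p \<in> W\<close> and H = insert.prems(3) and a = insert.prems(4)
    and eq = insert.prems(5) and ker = insert.prems(6)
  \<comment> \<open>A pivot exists: otherwise the unit vector at \<open>k\<close> would lie in the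
    left kernel.\<close>
  have "\<exists>j\<in>J. H k j p \<noteq> 0"
  proof (rule ccontr)
    assume *: "\<not> ?thesis"
    have "(\<Sum>i\<in>insert k I. (if i = k then 1 else 0) * H i j p) = 0" if "j \<in> J" for j
      using * that fin ki by (simp add: if_distrib[of "\<lambda>x. x * _"] cong: if_cong)
    from ker[OF this] show False by simp
  qed
  then obtain l where l: "l \<in> J" "H k l p \<noteq> 0" by blast
  have Hkl: "smooth_near p (H k l)" using H l(1) by blast
  obtain V where V: "open V" "p \<in> V" "\<forall>q\<in>V. H k l q \<noteq> 0"
    using smooth_near_nonzero_open[OF Hkl l(2)] by blast
  \<comment> \<open>Subtracting \<open>m j\<close> times equation \<open>l\<close> from equation
    \<open>j\<close> removes the unknown \<open>k\<close> throughout \<open>W \<inter> V\<close>.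
    This is why \<open>W\<close>, \<open>H\<close> and \<open>a\<close> vary in the
    induction.\<close>
  define m where "m j q = H k j q * inverse (H k l q)" for j q
  have m: "smooth_near p (m j)" if "j \<in> J" for j
    unfolding m_def using H[OF _ that] Hkl l(2) by (intro smooth_near_mult smooth_near_inverse) auto
  define H' where "H' i j q = H i j q - H i l q * m j q" for i j q
  define a' where "a' j q = a j q - a l q * m j q" for j q
  have eqk: "c k q * H k j q + (\<Sum>i\<in>I. c i q * H i j q) = a j q" if "j \<in> J" "q \<in> W" for j q
    using eq[OF that] fin ki by simp
  have I: "smooth_near p (c i)" if i: "i \<in> I" for i
  proof (rule insert.IH[of "W \<inter> V" H' a'])
    show "open (W \<inter> V)" "p \<in> W \<inter> V" using W V by auto
    show "smooth_near p (H' i j)" if "i \<in> I" "j \<in> J" for i j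
      unfolding H'_def using that l(1) by (intro smooth_near_diff smooth_near_mult H m) auto
    show "smooth_near p (a' j)" if "j \<in> J" for j
      unfolding a'_def using that l(1) by (intro smooth_near_diff smooth_near_mult a m)
    show "(\<Sum>i\<in>I. c i q * H' i j q) = a' j q" if j: "j \<in> J" and q: "q \<in> W \<inter> V" for j q
    proof -
      have "(\<Sum>i\<in>I. c i q * H' i j q) =
          (\<Sum>i\<in>I. c i q * H i j q) - (\<Sum>i\<in>I. c i q * H i l q) * m j q"
        by (simp add: H'_def right_diff_distrib mult.assoc sum_subtractf sum_distrib_right)
      also have "\<dots> = (a j q - c k q * H k j q) - (a l q - c k q * H k l q) * m j q"
      proof -
        have "(\<Sum>i\<in>I. c i q * H i j q) = a j q - c k q * H k j q"
          "(\<Sum>i\<in>I. c i q * H i l q) = a l q - c k q * H k l q"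
          using eqk[OF j, of q] eqk[OF l(1), of q] q by simp_all
        then show ?thesis by (simp only:)
      qed
      also have "\<dots> = a' j q"
        using V(3) q by (simp add: a'_def m_def algebra_simps)
      finally show ?thesis .
    qed
    show "\<forall>i\<in>I. u i = 0" if u: "\<And>j. j \<in> J \<Longrightarrow> (\<Sum>i\<in>I. u i * H' i j p) = 0" for u
    proof -
      \<comment> \<open>\<open>s\<close> is chosen to satisfy the pivot equation at
        \<open>p\<close>, so a kernel vector of the reduced system extends to one of the full
        system.\<close>
      define s where "s = - (\<Sum>i\<in>I. u i * H i l p) * inverse (H k l p)"
      define w where "w i = (if i = k then s else u i)" for i
      have "(\<Sum>i\<in>insert k I. w i * H i j p) = 0" if j: "j \<in> J" for j
      proof -
        have "(\<Sum>i\<in>insert k I. w i * H i j p) = s * H k j p + (\<Sum>i\<in>I. w i * H i j p)"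
          using fin ki by (simp add: w_def)
        also have "(\<Sum>i\<in>I. w i * H i j p) = (\<Sum>i\<in>I. u i * H i j p)"
          using ki by (intro sum.cong) (auto simp: w_def)
        also have "\<dots> = (\<Sum>i\<in>I. u i * H' i j p) + (\<Sum>i\<in>I. u i * H i l p) * m j p"
          by (simp add: H'_def right_diff_distrib mult.assoc sum_subtractf sum_distrib_right)
        finally show ?thesis using u[OF j] by (simp add: s_def m_def algebra_simps)
      qed
      from ker[OF this] have "\<forall>i\<in>insert k I. w i = 0" .
      then show ?thesis using ki by (auto simp: w_def split: if_splits)
    qed
    show "i \<in> I" by (rule i)
  qed
  \<comment> \<open>Back substitution in the pivot equation recovers the eliminated unknown.\<close>
  have "smooth_near p (\<lambda>q. (a l q - (\<Sum>i\<in>I. c i q * H i l q)) * inverse (H k l q))"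
    using l H by (intro smooth_near_mult smooth_near_diff smooth_near_sum smooth_near_inverse a I Hkl) auto
  then have "smooth_near p (c k)"
  proof (rule smooth_near_cong)
    show "open (W \<inter> V)" "p \<in> W \<inter> V" using W V by auto
    show "(a l q - (\<Sum>i\<in>I. c i q * H i l q)) * inverse (H k l q) = c k q" if "q \<in> W \<inter> V" for q
    proof -
      have "a l q - (\<Sum>i\<in>I. c i q * H i l q) = c k q * H k l q"
        using eqk[OF l(1), of q] that by simp
      then show ?thesis using V(3) that by simp
    qed
  qed
  then show ?case using I insert.prems(7) by blast
qed simp

end

section \<open>Brackets and the covariant derivative of 1-forms\<close>

context manifold
begin

lemma tangent_minus: "v \<in> TM p \<Longrightarrow> w \<in> TM p \<Longrightarrow> v - w \<in> TM p"
  unfolding tangent_iff by (simp add: algebra_simps)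

text \<open>In the Leibniz rule the mixed terms Xf * Yg + Yf * Xg are symmetric in X and Y and
  cancel in the commutator. For a non-smooth \<open>f\<close> both inner functions are identically
  0.\<close>

lemma lie_bracket_vector_field:
  assumes X: "X \<in> VM" and Y: "Y \<in> VM"
  shows "lie_bracket X Y \<in> VM"
proof (rule vector_fieldI)
  note t = vector_field_tangent[OF X] vector_field_tangent[OF Y]
  note s = vector_field_smooth[OF X] vector_field_smooth[OF Y]
  fix p
  show "lie_bracket X Y p \<in> TM p"
    unfolding tangent_iff
  proof (intro conjI ballI allI impI)
    fix f g assume fg: "f \<in> C" "g \<in> C"
    show "lie_bracket X Y p (\<lambda>q. f q + g q) = lie_bracket X Y p f + lie_bracket X Y p g"
      using fg by (simp add: lie_bracket_def tangent_add[OF t(1)] tangent_add[OF t(2)] s)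
    show "lie_bracket X Y p (\<lambda>q. f q * g q) = f p * lie_bracket X Y p g + g p * lie_bracket X Y p f"
      using fg by (simp add: lie_bracket_def tangent_add[OF t(1)] tangent_add[OF t(2)]
          tangent_mult[OF t(1)] tangent_mult[OF t(2)] s smooth_mult algebra_simps)
  next
    fix c f assume "f \<in> C"
    then show "lie_bracket X Y p (\<lambda>q. c * f q) = c * lie_bracket X Y p f"
      by (simp add: lie_bracket_def tangent_scale[OF t(1)] tangent_scale[OF t(2)] s algebra_simps)
  next
    fix f assume "f \<notin> C"
    then show "lie_bracket X Y p f = 0"
      by (simp add: lie_bracket_def tangent_outside[OF t(1)] tangent_outside[OF t(2)]
          tangent_const[OF t(1)] tangent_const[OF t(2)])
  qed
next
  show "(\<lambda>p. lie_bracket X Y p f) \<in> C" if "f \<in> C" for f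
    unfolding lie_bracket_def
    by (rule smooth_diff[OF vector_field_smooth[OF X vector_field_smooth[OF Y that]]
          vector_field_smooth[OF Y vector_field_smooth[OF X that]]])
qed

text \<open>The factor that J puts into a bracket is the constant \<open>\<epsilon>\<close>, so no
  derivative of a factor appears.\<close>

lemma lie_bracket_scl:
  assumes "X \<in> VM" "Y \<in> VM"
  shows "lie_bracket (\<lambda>p. scl c (X p)) Y = (\<lambda>p. scl c (lie_bracket X Y p))"
    and "lie_bracket X (\<lambda>p. scl c (Y p)) = (\<lambda>p. scl c (lie_bracket X Y p))"
proof -
  have *: "X p (\<lambda>q. c * Y q f) = c * X p (\<lambda>q. Y q f)" if X: "X \<in> VM" and Y: "Y \<in> VM" for X Y p f
  proof (cases "f \<in> C")
    case True
    show ?thesis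
      by (rule tangent_scale[OF vector_field_tangent[OF X] vector_field_smooth[OF Y True]])
  next
    case False
    then show ?thesis
      using tangent_outside[OF vector_field_tangent[OF Y]] tangent_const[OF vector_field_tangent[OF X]]
      by simp
  qed
  show "lie_bracket (\<lambda>p. scl c (X p)) Y = (\<lambda>p. scl c (lie_bracket X Y p))"
    using *[OF assms(2,1)] by (simp add: fun_eq_iff lie_bracket_def scl_def right_diff_distrib)
  show "lie_bracket X (\<lambda>p. scl c (Y p)) = (\<lambda>p. scl c (lie_bracket X Y p))"
    using *[OF assms] by (simp add: fun_eq_iff lie_bracket_def scl_def right_diff_distrib)
qed

lemma cotangent_plus: "\<xi> \<in> TM' p \<Longrightarrow> \<eta> \<in> TM' p \<Longrightarrow> \<xi> + \<eta> \<in> TM' p"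
  unfolding cotangent_iff by (simp add: algebra_simps)

lemma cotangent_minus: "\<xi> \<in> TM' p \<Longrightarrow> \<eta> \<in> TM' p \<Longrightarrow> \<xi> - \<eta> \<in> TM' p"
  unfolding cotangent_iff by (simp add: algebra_simps)

lemma cotangent_scl: "\<xi> \<in> TM' p \<Longrightarrow> scl c \<xi> \<in> TM' p"
  unfolding cotangent_iff by (simp add: scl_def[of c \<xi>] algebra_simps)

end

locale manifold_connection = manifold +
  fixes D :: "'a connection"
  assumes connection: "affine_connection A D"
begin

lemma connection_field: "X \<in> VM \<Longrightarrow> Y \<in> VM \<Longrightarrow> D X Y \<in> VM"
  and connection_scl: "X \<in> VM \<Longrightarrow> Y \<in> VM \<Longrightarrow> g \<in> C \<Longrightarrow>
    D (\<lambda>p. scl (g p) (X p)) Y = (\<lambda>p. scl (g p) (D X Y p))"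
  and connection_add_right: "X \<in> VM \<Longrightarrow> Y \<in> VM \<Longrightarrow> Z \<in> VM \<Longrightarrow> D X (Y + Z) = D X Y + D X Z"
  and connection_scl_right: "X \<in> VM \<Longrightarrow> Y \<in> VM \<Longrightarrow> g \<in> C \<Longrightarrow>
    D X (\<lambda>p. scl (g p) (Y p)) = (\<lambda>p. scl (X p g) (Y p) + scl (g p) (D X Y p))"
  using connection unfolding affine_connection_def by blast+

text \<open>For the field gY, the derivative of \<open>\<beta>\<close>(gY) along X and the value of
  \<open>\<beta>\<close> on the covariant derivative of gY both contain (Xg)
  \<open>\<beta>\<close>(Y). This term cancels, so the right-hand side is function-linear in
  Y.\<close>

lemma cov_form_exists:
  assumes X: "X \<in> VM" and \<beta>: "\<beta> \<in> FM"
  shows "\<exists>\<gamma>\<in>FM. \<forall>Y\<in>VM. \<forall>p. \<gamma> p (Y p) = X p (\<lambda>q. \<beta> q (Y q)) - \<beta> p (D X Y p)"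
proof (rule function_linear_one_form)
  note tX = vector_field_tangent[OF X] and t = vector_field_tangent
  note \<beta>T = one_form_cotangent[OF \<beta>] and \<beta>C = one_form_smooth[OF \<beta>]
  fix Y assume Y: "Y \<in> VM"
  show "(\<lambda>p. X p (\<lambda>q. \<beta> q (Y q)) - \<beta> p (D X Y p)) \<in> C"
    by (rule smooth_diff[OF vector_field_smooth[OF X \<beta>C[OF Y]] \<beta>C[OF connection_field[OF X Y]]])
  show "X p (\<lambda>q. \<beta> q ((Y + Z) q)) - \<beta> p (D X (Y + Z) p) =
      X p (\<lambda>q. \<beta> q (Y q)) - \<beta> p (D X Y p) + (X p (\<lambda>q. \<beta> q (Z q)) - \<beta> p (D X Z p))"
    if Z: "Z \<in> VM" for Z p
  proof -
    have "\<beta> q (v + w) = \<beta> q v + \<beta> q w" if "v \<in> TM q" "w \<in> TM q" for q v w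
      using \<beta>T that unfolding cotangent_iff by blast
    then show ?thesis
      using tangent_add[OF tX \<beta>C[OF Y] \<beta>C[OF Z]] t[OF Y] t[OF Z]
        t[OF connection_field[OF X Y]] t[OF connection_field[OF X Z]]
      by (simp add: connection_add_right[OF X Y Z])
  qed
  show "X p (\<lambda>q. \<beta> q (scl (g q) (Y q))) - \<beta> p (D X (\<lambda>p. scl (g p) (Y p)) p) =
      g p * (X p (\<lambda>q. \<beta> q (Y q)) - \<beta> p (D X Y p))" if g: "g \<in> C" for g p
  proof -
    have "\<beta> q (v + w) = \<beta> q v + \<beta> q w" if "v \<in> TM q" "w \<in> TM q" for q v w
      using \<beta>T that unfolding cotangent_iff by blast
    moreover have "\<beta> q (scl c v) = c * \<beta> q v" if "v \<in> TM q" for q v c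
      using \<beta>T that unfolding cotangent_iff by blast
    ultimately show ?thesis
      using tangent_mult[OF tX g \<beta>C[OF Y]] t[OF Y] t[OF connection_field[OF X Y]]
      by (simp add: connection_scl_right[OF X Y g] tangent_scl algebra_simps)
  qed
qed

lemma one_form_eqI:
  assumes "\<alpha> \<in> FM" "\<beta> \<in> FM" "\<And>X p. X \<in> VM \<Longrightarrow> \<alpha> p (X p) = \<beta> p (X p)"
  shows "\<alpha> = \<beta>"
proof
  show "\<alpha> p = \<beta> p" for p
    by (rule cotangent_eqI_fields[OF one_form_cotangent[OF assms(1)] one_form_cotangent[OF assms(2)] assms(3)])
qed

lemma cov_form:
  assumes X: "X \<in> VM" and \<beta>: "\<beta> \<in> FM"
  shows "cov_form A D X \<beta> \<in> FM"
    and "Y \<in> VM \<Longrightarrow> cov_form A D X \<beta> p (Y p) = X p (\<lambda>q. \<beta> q (Y q)) - \<beta> p (D X Y p)"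
proof -
  let ?P = "\<lambda>\<gamma>. \<gamma> \<in> FM \<and> (\<forall>Y\<in>VM. \<forall>p. \<gamma> p (Y p) = X p (\<lambda>q. \<beta> q (Y q)) - \<beta> p (D X Y p))"
  have "\<exists>!\<gamma>. ?P \<gamma>"
  proof (rule ex_ex1I)
    show "\<exists>\<gamma>. ?P \<gamma>" using cov_form_exists[OF assms] by blast
    show "\<gamma> = \<delta>" if "?P \<gamma>" "?P \<delta>" for \<gamma> \<delta>
      using that by (intro one_form_eqI) simp_all
  qed
  then have "?P (cov_form A D X \<beta>)"
    unfolding cov_form_def by (rule theI')
  then show "cov_form A D X \<beta> \<in> FM"
    "Y \<in> VM \<Longrightarrow> cov_form A D X \<beta> p (Y p) = X p (\<lambda>q. \<beta> q (Y q)) - \<beta> p (D X Y p)"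
    by blast+
qed

lemma cov_form_scl:
  assumes X: "X \<in> VM" and \<beta>: "\<beta> \<in> FM"
  shows "cov_form A D (\<lambda>p. scl c (X p)) \<beta> p = scl c (cov_form A D X \<beta> p)"
proof (rule cotangent_eqI_fields)
  note cX = vector_field_scl[OF smooth_const X, of c]
  show "cov_form A D (\<lambda>p. scl c (X p)) \<beta> p \<in> TM' p"
    by (rule one_form_cotangent[OF cov_form(1)[OF cX \<beta>]])
  show "scl c (cov_form A D X \<beta> p) \<in> TM' p"
    by (rule cotangent_scl[OF one_form_cotangent[OF cov_form(1)[OF X \<beta>]]])
  fix Y assume Y: "Y \<in> VM"
  have "\<beta> p (scl c (D X Y p)) = c * \<beta> p (D X Y p)"
    using one_form_cotangent[OF \<beta>] vector_field_tangent[OF connection_field[OF X Y]]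
    unfolding cotangent_iff by blast
  then show "cov_form A D (\<lambda>p. scl c (X p)) \<beta> p (Y p) = scl c (cov_form A D X \<beta> p) (Y p)"
    using cov_form(2)[OF cX \<beta> Y, of p] cov_form(2)[OF X \<beta> Y, of p]
    by (simp add: connection_scl[OF X Y smooth_const] scl_def[of c "cov_form A D X \<beta> p"]
        scl_def[of c "X p"] right_diff_distrib)
qed

end

section \<open>Inversion of a non-degenerate tensor field\<close>

text \<open>The word metric is a mere name here: \<open>h\<close> is not assumed symmetric or
  definite, so the order of its arguments matters.\<close>

locale manifold_metric = manifold A
  for A :: "('m::{t2_space, second_countable_topology}, 'e::euclidean_space) chart set" +
  fixes h :: "'m \<Rightarrow> 'm tvec \<Rightarrow> 'm tvec \<Rightarrow> real"
  assumes tensor: "h \<in> tensor_fields02 A" and nondegenerate: "nondegenerate A h"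
begin

lemma metric_cotangent: "v \<in> TM p \<Longrightarrow> h p v \<in> TM' p"
  and metric_add: "v \<in> TM p \<Longrightarrow> w \<in> TM p \<Longrightarrow> h p (v + w) = h p v + h p w"
  and metric_scl: "v \<in> TM p \<Longrightarrow> h p (scl c v) = scl c (h p v)"
  and metric_smooth: "X \<in> VM \<Longrightarrow> Y \<in> VM \<Longrightarrow> (\<lambda>p. h p (X p) (Y p)) \<in> C"
  using tensor unfolding tensor_fields02_def by blast+

lemma metric_field: "X \<in> VM \<Longrightarrow> (\<lambda>p. h p (X p)) \<in> FM"
  unfolding one_forms_def by (simp add: metric_cotangent metric_smooth vector_field_tangent)

lemma metric_minus:
  assumes "v \<in> TM p" "w \<in> TM p"
  shows "h p (v - w) = h p v - h p w"
proof -
  have "v - w = v + scl (-1) w" by (simp add: fun_eq_iff scl_def)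
  then have "h p (v - w) = h p v + scl (-1) (h p w)"
    by (simp only: metric_add[OF assms(1) tangent_scl[OF assms(2)]] metric_scl[OF assms(2)])
  then show ?thesis by (simp add: fun_eq_iff scl_def)
qed

lemma metric_linear_combination:
  assumes "\<And>i. i \<in> I \<Longrightarrow> v i \<in> TM p"
  shows "h p (\<lambda>f. \<Sum>i\<in>I. c i * v i f) w = (\<Sum>i\<in>I. c i * h p (v i) w)"
proof -
  have "h p (scl 0 (\<lambda>f. 0)) w = scl 0 (h p (\<lambda>f. 0)) w"
    by (simp only: metric_scl[OF zero_tangent])
  then have z: "h p (\<lambda>f. 0) w = 0" by (simp add: scl_def)
  show ?thesis
    using assms
  proof (induction I rule: infinite_finite_induct)
    case (insert i I)
    have "(\<lambda>f. \<Sum>i\<in>insert i I. c i * v i f) = scl (c i) (v i) + (\<lambda>f. \<Sum>i\<in>I. c i * v i f)"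
      using insert.hyps by (simp add: fun_eq_iff scl_def)
    moreover have "v i \<in> TM p" "scl (c i) (v i) \<in> TM p" "(\<lambda>f. \<Sum>i\<in>I. c i * v i f) \<in> TM p"
      using insert.prems by (auto intro: tangent_scl tangent_linear_combination)
    ultimately show ?case
      using insert by (simp add: metric_add metric_scl) (simp add: scl_def)
  qed (simp_all add: z)
qed

lemma metric_inject:
  assumes "v \<in> TM p" "w \<in> TM p" "h p v = h p w"
  shows "v = w"
proof -
  have "h p (v - w) u = 0" for u using assms by (simp add: metric_minus)
  then have "v - w = 0"
    using nondegenerate tangent_minus[OF assms(1,2)] unfolding nondegenerate_def by blast
  then show ?thesis by simp
qed

text \<open>A left kernel vector \<open>u\<close> of the Gram matrix gives v = \<Sum> u_b E_b with
  h(v, -) = 0, hence v = 0; applying v to \<open>x b\<close> isolates \<open>u b\<close>. This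
  serves both surjectivity and the kernel condition of \<open>smooth_near_solution\<close>.\<close>

lemma gram_kernel:
  assumes E: "\<And>b. E b \<in> TM p"
    and dual: "\<And>b b'. b \<in> Basis \<Longrightarrow> b' \<in> Basis \<Longrightarrow> E b (x b') = (if b = b' then 1 else 0)"
    and span: "\<And>v. v \<in> TM p \<Longrightarrow> (\<lambda>f. \<Sum>b\<in>(Basis :: 'e set). v (x b) * E b f) = v"
    and u: "\<And>b'. b' \<in> Basis \<Longrightarrow> (\<Sum>b\<in>(Basis :: 'e set). u b * h p (E b) (E b')) = 0"
    and b: "b \<in> Basis"
  shows "u b = 0"
proof -
  define v where "v = (\<lambda>f. \<Sum>b\<in>(Basis :: 'e set). u b * E b f)"
  have v: "v \<in> TM p" unfolding v_def using E by (rule tangent_linear_combination)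
  have "h p v (E b') = 0" if "b' \<in> Basis" for b'
    unfolding v_def using u[OF that] metric_linear_combination[of "Basis :: 'e set" E p u, OF E] by simp
  then have "h p v w = 0" if w: "w \<in> TM p" for w
    using cotangent_linear_combination[OF metric_cotangent[OF v], of "Basis :: 'e set" E "\<lambda>b. w (x b)", OF E]
    unfolding span[OF w] by simp
  then have "v = 0" using nondegenerate v unfolding nondegenerate_def by blast
  then have "(\<Sum>b'\<in>(Basis :: 'e set). u b' * E b' (x b)) = 0"
    unfolding v_def by (simp add: fun_eq_iff)
  then show ?thesis using dual b by (simp add: if_distrib[of "\<lambda>x. _ * x"] cong: if_cong)
qed

text \<open>Injectivity implies surjectivity by dimension. Tangent vectors are bare functions, so
  the count is carried out in the model space \<open>'e\<close> through coordinates.\<close>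

lemma metric_surj:
  assumes \<xi>: "\<xi> \<in> TM' p"
  shows "\<exists>v\<in>TM p. h p v = \<xi>"
proof (rule local_frame[of p])
  fix \<psi> x F
  assume F: "\<And>b. F b \<in> VM" and \<psi>: "\<psi> p = 1"
    and dual: "\<And>b b'. b \<in> Basis \<Longrightarrow> b' \<in> Basis \<Longrightarrow> F b p (x b') = (if b = b' then 1 else 0)"
    and decomp: "\<And>q v. v \<in> TM q \<Longrightarrow> scl (\<psi> q) v = (\<lambda>f. \<Sum>b\<in>(Basis :: 'e set). v (x b) * F b q f)"
  have E: "F b p \<in> TM p" for b by (rule vector_field_tangent[OF F])
  have span: "(\<lambda>f. \<Sum>b\<in>(Basis :: 'e set). v (x b) * F b p f) = v" if "v \<in> TM p" for v
    unfolding decomp[OF that, symmetric] by (simp add: \<psi> scl_def)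
  \<comment> \<open>The Gram matrix as an endomorphism of the model space: it sends the coordinates
    of v to the values of h(v, -) on the frame.\<close>
  define L :: "'e \<Rightarrow> 'e" where
    "L c = (\<Sum>b'\<in>Basis. (\<Sum>b\<in>Basis. (c \<bullet> b) * h p (F b p) (F b' p)) *\<^sub>R b')" for c
  have "linear L"
    unfolding L_def by (intro linearI)
      (simp_all add: inner_add_left distrib_right sum.distrib scaleR_add_left scaleR_sum_right
        sum_distrib_left mult.assoc)
  moreover have "c = 0" if "L c = 0" for c
  proof -
    have k: "(\<Sum>b\<in>Basis. (c \<bullet> b) * h p (F b p) (F b' p)) = 0" if "b' \<in> Basis" for b'
    proof -
      have "L c \<bullet> b' = (\<Sum>b\<in>Basis. (c \<bullet> b) * h p (F b p) (F b' p))"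
        unfolding L_def using that by (simp only: inner_sum_left_Basis)
      then show ?thesis using \<open>L c = 0\<close> by simp
    qed
    have "c \<bullet> b = 0" if "b \<in> Basis" for b
      by (rule gram_kernel[where E = "\<lambda>b. F b p" and x = x and u = "\<lambda>b. c \<bullet> b",
            OF E dual span k that])
    then show ?thesis using euclidean_all_zero_iff[of c] by blast
  qed
  ultimately have "surj L"
    using linear_injective_0 linear_injective_imp_surjective by blast
  then obtain c where c: "L c = (\<Sum>b'\<in>Basis. \<xi> (F b' p) *\<^sub>R b')" by (metis surjD)
  define v where "v = (\<lambda>f. \<Sum>b\<in>(Basis :: 'e set). (c \<bullet> b) * F b p f)"
  have v: "v \<in> TM p" unfolding v_def using E by (rule tangent_linear_combination)
  have eq: "h p v (F b' p) = \<xi> (F b' p)" if b': "b' \<in> Basis" for b'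
  proof -
    have "h p v (F b' p) = L c \<bullet> b'"
      unfolding v_def L_def inner_sum_left_Basis[OF b'] by (rule metric_linear_combination[OF E])
    also have "\<dots> = \<xi> (F b' p)" unfolding c inner_sum_left_Basis[OF b'] ..
    finally show ?thesis .
  qed
  have "h p v = \<xi>"
  proof (rule cotangent_eqI[OF metric_cotangent[OF v] \<xi>])
    fix w assume w: "w \<in> TM p"
    note l = cotangent_linear_combination[of _ p "Basis :: 'e set" "\<lambda>b. F b p" "\<lambda>b. w (x b)", OF _ E,
        unfolded span[OF w]]
    show "h p v w = \<xi> w"
      unfolding l[OF metric_cotangent[OF v]] l[OF \<xi>] by (simp add: eq)
  qed
  then show ?thesis using v by blast
qed

lemma h_inv:
  assumes "\<xi> \<in> TM' p"
  shows "h_inv A h p \<xi> \<in> TM p" "h p (h_inv A h p \<xi>) = \<xi>"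
proof -
  have "\<xi> \<in> h p ` TM p" using metric_surj[OF assms] by blast
  then show "h_inv A h p \<xi> \<in> TM p" "h p (h_inv A h p \<xi>) = \<xi>"
    unfolding h_inv_def by (rule inv_into_into, rule f_inv_into_f)
qed

lemma h_inv_metric: "v \<in> TM p \<Longrightarrow> h_inv A h p (h p v) = v"
  using h_inv[OF metric_cotangent] metric_inject by blast

lemma h_inv_field:
  assumes \<alpha>: "\<alpha> \<in> FM"
  shows "(\<lambda>p. h_inv A h p (\<alpha> p)) \<in> VM"
proof (rule vector_fieldI)
  let ?Y = "\<lambda>p. h_inv A h p (\<alpha> p)"
  note Y = h_inv[OF one_form_cotangent[OF \<alpha>]]
  show "?Y p \<in> TM p" for p by (rule Y(1))
  fix f assume f: "f \<in> C"
  show "(\<lambda>p. ?Y p f) \<in> C"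
    unfolding smooth_functions_iff
  proof (intro allI, rule local_frame)
    fix p \<psi> x F
    assume \<psi>C: "\<psi> \<in> C" and F: "\<And>b. F b \<in> VM" and \<psi>: "\<psi> p = 1"
      and dual: "\<And>b b'. b \<in> Basis \<Longrightarrow> b' \<in> Basis \<Longrightarrow> F b p (x b') = (if b = b' then 1 else 0)"
      and decomp: "\<And>q v. v \<in> TM q \<Longrightarrow> scl (\<psi> q) v = (\<lambda>f. \<Sum>b\<in>(Basis :: 'e set). v (x b) * F b q f)"
    note near = smooth_functions_iff[THEN iffD1, rule_format]
    have E: "F b q \<in> TM q" for b q by (rule vector_field_tangent[OF F])
    have span: "(\<lambda>f. \<Sum>b\<in>(Basis :: 'e set). v (x b) * F b p f) = v" if "v \<in> TM p" for v
      unfolding decomp[OF that, symmetric] by (simp add: \<psi> scl_def)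
    have c: "smooth_near p (\<lambda>q. ?Y q (x b))" if "b \<in> Basis" for b
    \<comment> \<open>Pairing the expansion of \<open>\<psi>Y\<close> with the frame fields through
      \<open>h\<close> gives linear equations for the coefficients Y(x_b), with smooth matrix and
      smooth right-hand side.\<close>
    proof (rule smooth_near_solution[where I = "Basis :: 'e set" and J = "Basis :: 'e set" and
          W = UNIV and c = "\<lambda>b q. ?Y q (x b)" and H = "\<lambda>b b' q. h q (F b q) (F b' q)" and
          a = "\<lambda>b q. \<psi> q * \<alpha> q (F b q)"])
      show "smooth_near p (\<lambda>q. h q (F b q) (F b' q))" for b b'
        by (rule near[OF metric_smooth[OF F F]])
      show "smooth_near p (\<lambda>q. \<psi> q * \<alpha> q (F b q))" for b
        by (rule near[OF smooth_mult[OF \<psi>C one_form_smooth[OF \<alpha> F]]])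
      show "(\<Sum>b\<in>Basis. ?Y q (x b) * h q (F b q) (F b' q)) = \<psi> q * \<alpha> q (F b' q)" for b' q
      proof -
        have "h q (scl (\<psi> q) (?Y q)) (F b' q) = (\<Sum>b\<in>Basis. ?Y q (x b) * h q (F b q) (F b' q))"
          unfolding decomp[OF Y(1)] by (rule metric_linear_combination[OF E])
        moreover have "h q (scl (\<psi> q) (?Y q)) = scl (\<psi> q) (\<alpha> q)"
          unfolding metric_scl[OF Y(1)] Y(2) ..
        ultimately show ?thesis by (simp add: scl_def)
      qed
      show "\<forall>b\<in>Basis. u b = 0"
        if u: "\<And>b'. b' \<in> Basis \<Longrightarrow> (\<Sum>b\<in>(Basis :: 'e set). u b * h p (F b p) (F b' p)) = 0" for u
      proof
        show "u b = 0" if "b \<in> Basis" for b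
          by (rule gram_kernel[where E = "\<lambda>b. F b p" and x = x, OF E dual span u that])
      qed
    qed (use that in auto)
    \<comment> \<open>The frame expands \<open>\<psi>Y\<close>; dividing by \<open>\<psi>\<close>,
      which is nonzero near \<open>p\<close>, returns Y.\<close>
    have quotient: "smooth_near p (\<lambda>q. inverse (\<psi> q) * (\<Sum>b\<in>Basis. ?Y q (x b) * F b q f))"
      by (intro smooth_near_mult smooth_near_inverse smooth_near_sum c near[OF \<psi>C]
          near[OF vector_field_smooth[OF F f]]) (simp_all add: \<psi>)
    have "\<psi> p \<noteq> 0" using \<psi> by simp
    then obtain W where W: "open W" "p \<in> W" "\<forall>q\<in>W. \<psi> q \<noteq> 0"
      using smooth_near_nonzero_open[OF near[OF \<psi>C]] by blast
    show "smooth_near p (\<lambda>q. ?Y q f)"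
    proof (rule smooth_near_cong[OF quotient W(1,2)])
      fix q assume "q \<in> W"
      then show "inverse (\<psi> q) * (\<Sum>b\<in>Basis. ?Y q (x b) * F b q f) = ?Y q f"
        using fun_cong[OF decomp[OF Y(1)], of q f] W(3) by (simp add: scl_def field_simps)
    qed
  qed
qed

end

section \<open>The Nijenhuis tensor\<close>

locale metric_connection = manifold_metric A h + manifold_connection A D
  for A :: "('m::{t2_space, second_countable_topology}, 'e::euclidean_space) chart set"
    and h :: "'m \<Rightarrow> 'm tvec \<Rightarrow> 'm tvec \<Rightarrow> real"
    and D :: "'m connection"
begin

text \<open>This is Q(X, Y) of the overview. Keeping the third field out makes it a covector at each
  point, to which \<open>h_inv\<close> can be applied.\<close>

definition d_nabla_form :: "('m \<Rightarrow> 'm tvec) \<Rightarrow> ('m \<Rightarrow> 'm tvec) \<Rightarrow> 'm \<Rightarrow> 'm cvec" where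
  "d_nabla_form X Y p = cov_form A D X (\<lambda>p. h p (Y p)) p - cov_form A D Y (\<lambda>p. h p (X p)) p
     - h p (lie_bracket X Y p)"

lemma cov_metric_cotangent: "X \<in> VM \<Longrightarrow> Y \<in> VM \<Longrightarrow> cov_form A D X (\<lambda>p. h p (Y p)) p \<in> TM' p"
  by (rule one_form_cotangent[OF cov_form(1)[OF _ metric_field]])

lemma d_nabla_form_cotangent: "X \<in> VM \<Longrightarrow> Y \<in> VM \<Longrightarrow> d_nabla_form X Y p \<in> TM' p"
  unfolding d_nabla_form_def
  by (intro cotangent_minus cov_metric_cotangent metric_cotangent
      vector_field_tangent[OF lie_bracket_vector_field])

text \<open>The terms of \<open>cov_tensor\<close> that differentiate the first argument of
  \<open>h\<close> cancel against the torsion, of which only the Lie bracket remains.\<close>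

lemma d_nabla_form_apply:
  assumes "X \<in> VM" "Y \<in> VM" "Z \<in> VM"
  shows "d_nabla_form X Y p (Z p) = d_nabla D h X Y Z p"
proof -
  note t = vector_field_tangent
  have "h p (torsion D X Y p) = h p (D X Y p) - h p (D Y X p) - h p (lie_bracket X Y p)"
    using t[OF connection_field[OF assms(1,2)], of p] t[OF connection_field[OF assms(2,1)], of p]
      t[OF lie_bracket_vector_field[OF assms(1,2)], of p]
    by (simp add: torsion_def metric_minus tangent_minus)
  then show ?thesis
    by (simp add: d_nabla_form_def d_nabla_def cov_tensor_def cov_form(2)[OF assms(1) metric_field[OF assms(2)] assms(3)]
        cov_form(2)[OF assms(2) metric_field[OF assms(1)] assms(3)])
qed

lemma quasi_statistical_iff: "quasi_statistical A h D \<longleftrightarrow> (\<forall>X\<in>VM. \<forall>Y\<in>VM. \<forall>p. d_nabla_form X Y p = 0)"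
proof
  assume *: "quasi_statistical A h D"
  show "\<forall>X\<in>VM. \<forall>Y\<in>VM. \<forall>p. d_nabla_form X Y p = 0"
  proof (intro ballI allI)
    fix X Y p assume XY: "X \<in> VM" "Y \<in> VM"
    show "d_nabla_form X Y p = 0"
    proof (rule cotangent_eqI_fields[OF d_nabla_form_cotangent[OF XY]])
      show "0 \<in> TM' p" unfolding cotangent_iff by simp
      show "d_nabla_form X Y p (Z p) = 0 (Z p)" if "Z \<in> VM" for Z
        using * XY that unfolding quasi_statistical_def by (simp add: d_nabla_form_apply)
    qed
  qed
next
  assume "\<forall>X\<in>VM. \<forall>Y\<in>VM. \<forall>p. d_nabla_form X Y p = 0"
  then show "quasi_statistical A h D"
    unfolding quasi_statistical_def by (simp add: d_nabla_form_apply[symmetric])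
qed

definition J :: "real \<Rightarrow> 'm gen_endo" where
  "J \<epsilon> = (\<lambda>p (v, \<xi>). (scl \<epsilon> (h_inv A h p \<xi>), h p v))"

lemma J_c_eq: "J_c A h = J (-1)"
  and J_p_eq: "J_p A h = J 1"
  unfolding J_c_def J_p_def J_def by (auto simp: fun_eq_iff scl_def)

text \<open>Through \<open>h\<close> a section becomes a pair of vector fields, and J sends (X, Y)
  to (\<open>\<epsilon>\<close>Y, X), as \<open>J_sec\<close> shows.\<close>

abbreviation sec :: "('m \<Rightarrow> 'm tvec) \<Rightarrow> ('m \<Rightarrow> 'm tvec) \<Rightarrow> 'm \<Rightarrow> 'm tvec \<times> 'm cvec" where
  "sec X Y \<equiv> \<lambda>p. (X p, h p (Y p))"

lemma sec_section: "X \<in> VM \<Longrightarrow> Y \<in> VM \<Longrightarrow> sec X Y \<in> gen_sections A"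
  by (simp add: gen_sections_def o_def metric_field)

text \<open>Here the smoothness of \<open>h_inv\<close> on 1-forms enters: the second field has to
  be a smooth one.\<close>

lemma section_cases:
  assumes "\<sigma> \<in> gen_sections A"
  obtains X Y where "X \<in> VM" "Y \<in> VM" "\<sigma> = sec X Y"
proof
  have s: "fst \<circ> \<sigma> \<in> VM" "snd \<circ> \<sigma> \<in> FM" using assms unfolding gen_sections_def by auto
  show "fst \<circ> \<sigma> \<in> VM" by (rule s(1))
  show "(\<lambda>p. h_inv A h p ((snd \<circ> \<sigma>) p)) \<in> VM" by (rule h_inv_field[OF s(2)])
  show "\<sigma> = sec (fst \<circ> \<sigma>) (\<lambda>p. h_inv A h p ((snd \<circ> \<sigma>) p))"
    unfolding h_inv(2)[OF one_form_cotangent[OF s(2)]] by simp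
qed

lemma J_sec: "Y \<in> VM \<Longrightarrow> on_section (J \<epsilon>) (sec X Y) = sec (\<lambda>p. scl \<epsilon> (Y p)) X"
  by (simp add: on_section_def J_def h_inv_metric vector_field_tangent)

lemma h_inv_add:
  assumes "\<xi> \<in> TM' p" "\<eta> \<in> TM' p"
  shows "h_inv A h p (\<xi> + \<eta>) = h_inv A h p \<xi> + h_inv A h p \<eta>"
  using assms
  by (intro metric_inject[of _ p]) (simp_all add: h_inv metric_add tangent_plus cotangent_plus)

lemma h_inv_scl:
  assumes "\<xi> \<in> TM' p"
  shows "h_inv A h p (scl c \<xi>) = scl c (h_inv A h p \<xi>)"
  using assms
  by (intro metric_inject[of _ p]) (simp_all add: h_inv metric_scl tangent_scl cotangent_scl)

lemma J_bundle_endomorphism: "bundle_endomorphism A (J \<epsilon>)"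
  unfolding bundle_endomorphism_def
proof (intro conjI allI ballI)
  fix p x assume x: "x \<in> gen_fibre A p"
  show "J \<epsilon> p x \<in> gen_fibre A p"
    using x by (auto simp: gen_fibre_def J_def intro: tangent_scl h_inv metric_cotangent)
  show "J \<epsilon> p (x + y) = J \<epsilon> p x + J \<epsilon> p y" if "y \<in> gen_fibre A p" for y
    using x that
    by (auto simp: gen_fibre_def J_def metric_add h_inv_add) (simp add: scl_def fun_eq_iff distrib_left)
  show "J \<epsilon> p (map_prod (scl c) (scl c) x) = map_prod (scl c) (scl c) (J \<epsilon> p x)" for c
    using x by (auto simp: gen_fibre_def J_def metric_scl h_inv_scl) (simp add: scl_def fun_eq_iff)
next
  fix \<sigma> assume "\<sigma> \<in> gen_sections A"
  then obtain X Y where XY: "X \<in> VM" "Y \<in> VM" "\<sigma> = sec X Y" by (rule section_cases)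
  then show "on_section (J \<epsilon>) \<sigma> \<in> gen_sections A"
    by (simp add: J_sec sec_section vector_field_scl[OF smooth_const])
qed

text \<open>Each component passes once through \<open>h\<close>, once through its inverse and picks
  up one factor \<open>\<epsilon>\<close>; so the square is I for \<open>J_p\<close> and -I for
  \<open>J_c\<close>.\<close>

lemma J_square:
  assumes "x \<in> gen_fibre A p"
  shows "J \<epsilon> p (J \<epsilon> p x) = map_prod (scl \<epsilon>) (scl \<epsilon>) x"
  using assms
  by (auto simp: gen_fibre_def J_def h_inv h_inv_metric metric_scl)

lemma nabla_bracket_sec:
  "nabla_bracket A D (sec X A') (sec Y B) = (\<lambda>p. (lie_bracket X Y p,
     cov_form A D X (\<lambda>p. h p (B p)) p - cov_form A D Y (\<lambda>p. h p (A' p)) p))"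
  by (simp add: nabla_bracket_def o_def)

text \<open>The vector part is described by its image under \<open>h\<close>, which keeps
  \<open>h_inv\<close> out of the formula; with the membership in \<open>TM p\<close>,
  non-degeneracy recovers the vector.\<close>

lemma nijenhuis_sec:
  assumes \<epsilon>: "\<epsilon> * \<epsilon> = 1" and X: "X \<in> VM" and A: "A' \<in> VM" and Y: "Y \<in> VM" and B: "B \<in> VM"
  shows "fst (nijenhuis A D (J \<epsilon>) (sec X A') (sec Y B) p) \<in> TM p" (is "fst ?N \<in> _")
    and "h p (fst (nijenhuis A D (J \<epsilon>) (sec X A') (sec Y B) p)) = - d_nabla_form A' B p - scl \<epsilon> (d_nabla_form X Y p)"
    and "snd (nijenhuis A D (J \<epsilon>) (sec X A') (sec Y B) p) = scl \<epsilon> (d_nabla_form A' Y p + d_nabla_form X B p)"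
proof -
  let ?c = "\<lambda>X Y. cov_form A D X (\<lambda>p. h p (Y p)) p"
  note t = vector_field_tangent and l = lie_bracket_vector_field
  let ?\<epsilon>A = "\<lambda>p. scl \<epsilon> (A' p)" and ?\<epsilon>B = "\<lambda>p. scl \<epsilon> (B p)"
  have \<epsilon>A: "?\<epsilon>A \<in> VM" and \<epsilon>B: "?\<epsilon>B \<in> VM"
    using vector_field_scl[OF smooth_const] A B by auto
  have cA: "cov_form A D ?\<epsilon>A (\<lambda>p. h p (Z p)) p = scl \<epsilon> (?c A' Z)" if "Z \<in> VM" for Z
    by (rule cov_form_scl[OF A metric_field[OF that]])
  have cB: "cov_form A D ?\<epsilon>B (\<lambda>p. h p (Z p)) p = scl \<epsilon> (?c B Z)" if "Z \<in> VM" for Z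
    by (rule cov_form_scl[OF B metric_field[OF that]])
  have ss: "scl \<epsilon> (scl \<epsilon> u) = u" for u :: "'x \<Rightarrow> real"
    using \<epsilon> by (simp add: scl_def fun_eq_iff flip: mult.assoc)
  \<comment> \<open>The covector parts of the mixed brackets: \<open>?\<eta>\<close> belongs to J on
    the first section, \<open>?\<zeta>\<close> to J on the second.\<close>
  let ?\<eta> = "scl \<epsilon> (?c A' B) - ?c Y X" and ?\<zeta> = "?c X Y - scl \<epsilon> (?c B A')"
  have \<eta>: "?\<eta> \<in> TM' p" and \<zeta>: "?\<zeta> \<in> TM' p"
    by (intro cotangent_minus cotangent_scl cov_metric_cotangent X Y A B)+
  let ?\<theta> = "?c X B - ?c Y A'"
  have \<theta>: "?\<theta> \<in> TM' p" by (intro cotangent_minus cov_metric_cotangent X Y A B)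
  have N: "?N = (lie_bracket A' B p - scl \<epsilon> (h_inv A h p ?\<eta>) - scl \<epsilon> (h_inv A h p ?\<zeta>)
       + scl \<epsilon> (lie_bracket X Y p),
      scl \<epsilon> (?c A' Y) - scl \<epsilon> (?c B X) - h p (scl \<epsilon> (lie_bracket A' Y p))
       - h p (scl \<epsilon> (lie_bracket X B p)) + h p (scl \<epsilon> (h_inv A h p ?\<theta>)))"
    unfolding nijenhuis_def J_sec[OF A] J_sec[OF B] nabla_bracket_sec
    by (simp add: on_section_def J_def h_inv_metric t[OF l[OF X Y]] cA cB X Y A B \<epsilon>A \<epsilon>B
        lie_bracket_scl ss)
  note tt = t[OF l[OF A B], of p] t[OF l[OF X Y], of p] t[OF l[OF A Y], of p] t[OF l[OF X B], of p]
    h_inv[OF \<eta>] h_inv[OF \<zeta>] h_inv[OF \<theta>]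
  show "fst ?N \<in> TM p"
    unfolding N fst_conv by (intro tangent_plus tangent_minus tangent_scl tt)
  show "h p (fst ?N) = - d_nabla_form A' B p - scl \<epsilon> (d_nabla_form X Y p)"
  proof -
    have "h p (fst ?N) = h p (lie_bracket A' B p) - scl \<epsilon> ?\<eta> - scl \<epsilon> ?\<zeta> + scl \<epsilon> (h p (lie_bracket X Y p))"
      unfolding N fst_conv using tt
      by (simp add: metric_add metric_minus metric_scl tangent_minus tangent_scl)
    \<comment> \<open>The terms in \<open>A'\<close> and \<open>B\<close> carry
      \<open>\<epsilon> * \<epsilon> = 1\<close>, those in \<open>X\<close> and \<open>Y\<close> a
      single \<open>\<epsilon>\<close>, which separates the two forms.\<close>
    also have "\<dots> = - d_nabla_form A' B p - scl \<epsilon> (d_nabla_form X Y p)"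
      using \<epsilon> by (simp add: d_nabla_form_def scl_def fun_eq_iff algebra_simps flip: mult.assoc)
    finally show ?thesis .
  qed
  show "snd ?N = scl \<epsilon> (d_nabla_form A' Y p + d_nabla_form X B p)"
  proof -
    have "snd ?N = scl \<epsilon> (?c A' Y) - scl \<epsilon> (?c B X) - scl \<epsilon> (h p (lie_bracket A' Y p))
        - scl \<epsilon> (h p (lie_bracket X B p)) + scl \<epsilon> ?\<theta>"
      unfolding N snd_conv using tt by (simp add: metric_scl)
    also have "\<dots> = scl \<epsilon> (d_nabla_form A' Y p + d_nabla_form X B p)"
      by (simp add: d_nabla_form_def scl_def fun_eq_iff algebra_simps)
    finally show ?thesis .
  qed
qed

lemma nabla_integrable_J_iff:
  assumes \<epsilon>: "\<epsilon> = 1 \<or> \<epsilon> = -1"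
  shows "nabla_integrable A D (J \<epsilon>) \<longleftrightarrow> quasi_statistical A h D"
proof -
  have \<epsilon>2: "\<epsilon> * \<epsilon> = 1" using \<epsilon> by auto
  have "(\<forall>p. \<forall>x\<in>gen_fibre A p. J \<epsilon> p (J \<epsilon> p x) = x) \<or> (\<forall>p. \<forall>x\<in>gen_fibre A p. J \<epsilon> p (J \<epsilon> p x) = - x)"
    using \<epsilon>
  proof
    have "map_prod (scl 1) (scl 1) x = x" for x :: "'m tvec \<times> 'm cvec"
      by (cases x) (simp add: scl_def)
    then show ?thesis if "\<epsilon> = 1" using that J_square by simp
    have "map_prod (scl (-1)) (scl (-1)) x = - x" for x :: "'m tvec \<times> 'm cvec"
      by (cases x) (simp add: scl_def fun_eq_iff)
    then show ?thesis if "\<epsilon> = -1" using that J_square by simp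
  qed
  then have "nabla_integrable A D (J \<epsilon>) \<longleftrightarrow>
      (\<forall>\<sigma>\<in>gen_sections A. \<forall>\<tau>\<in>gen_sections A. \<forall>p. nijenhuis A D (J \<epsilon>) \<sigma> \<tau> p = 0)"
    using J_bundle_endomorphism unfolding nabla_integrable_def by blast
  also have "\<dots> \<longleftrightarrow> (\<forall>X\<in>VM. \<forall>Y\<in>VM. \<forall>p. d_nabla_form X Y p = 0)"
  proof
    assume N: "\<forall>\<sigma>\<in>gen_sections A. \<forall>\<tau>\<in>gen_sections A. \<forall>p. nijenhuis A D (J \<epsilon>) \<sigma> \<tau> p = 0"
    show "\<forall>X\<in>VM. \<forall>Y\<in>VM. \<forall>p. d_nabla_form X Y p = 0"
    proof (intro ballI allI)
      fix X Y p assume X: "X \<in> VM" and Y: "Y \<in> VM"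
      note z = zero_vector_field
      \<comment> \<open>Both covariant derivatives in Q(0, 0) are the same expression and
        cancel.\<close>
      have form0: "d_nabla_form (\<lambda>p f. 0) (\<lambda>p f. 0) p = 0"
      proof -
        have "lie_bracket (\<lambda>p f. 0) (\<lambda>p f. 0) p = (0 :: 'm tvec)"
          by (simp add: lie_bracket_def fun_eq_iff)
        moreover have "h p 0 = 0"
          using metric_minus[OF zero_tangent zero_tangent, of p] by (simp flip: zero_fun_def)
        ultimately show ?thesis by (simp add: d_nabla_form_def)
      qed
      \<comment> \<open>Testing on the sections X and hY makes the covector part equal to
        \<open>\<epsilon>\<close>(Q(0, 0) + Q(X, Y)).\<close>
      have "nijenhuis A D (J \<epsilon>) (sec X (\<lambda>p f. 0)) (sec (\<lambda>p f. 0) Y) p = 0"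
        using N sec_section[OF X z] sec_section[OF z Y] by blast
      then have "scl \<epsilon> (d_nabla_form (\<lambda>p f. 0) (\<lambda>p f. 0) p + d_nabla_form X Y p) = 0"
        using nijenhuis_sec(3)[OF \<epsilon>2 X z z Y, of p] by simp
      then have "scl \<epsilon> (d_nabla_form X Y p) = 0" by (simp add: form0)
      then show "d_nabla_form X Y p = 0" using \<epsilon> by (auto simp: scl_def fun_eq_iff)
    qed
  next
    assume zero: "\<forall>X\<in>VM. \<forall>Y\<in>VM. \<forall>p. d_nabla_form X Y p = 0"
    show "\<forall>\<sigma>\<in>gen_sections A. \<forall>\<tau>\<in>gen_sections A. \<forall>p. nijenhuis A D (J \<epsilon>) \<sigma> \<tau> p = 0"
    proof (intro ballI allI)
      fix \<sigma> \<tau> p assume "\<sigma> \<in> gen_sections A" "\<tau> \<in> gen_sections A"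
      then obtain X A' Y B where s: "X \<in> VM" "A' \<in> VM" "\<sigma> = sec X A'" "Y \<in> VM" "B \<in> VM" "\<tau> = sec Y B"
        by (elim section_cases)
      let ?N = "nijenhuis A D (J \<epsilon>) (sec X A') (sec Y B) p"
      note n = nijenhuis_sec[OF \<epsilon>2 s(1,2,4,5), of p]
      \<comment> \<open>The vector part is known only through \<open>h\<close>, so its vanishing is
        deduced from non-degeneracy.\<close>
      have "h p (fst ?N) w = 0" for w
        using n(2) zero s(1,2,4,5) by (simp add: scl_def)
      then have "fst ?N = 0"
        using nondegenerate n(1) unfolding nondegenerate_def by blast
      moreover have "snd ?N = 0"
        using n(3) zero s(1,2,4,5) by (simp add: scl_def fun_eq_iff)
      ultimately show "nijenhuis A D (J \<epsilon>) \<sigma> \<tau> p = 0"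
        unfolding s(3,6) by (simp add: prod_eq_iff)
    qed
  qed
  finally show ?thesis unfolding quasi_statistical_iff .
qed

end

theorem proposition2p4:
  fixes A :: "('m::{t2_space, second_countable_topology}, 'e::euclidean_space) chart set"
    and h :: "'m \<Rightarrow> 'm tvec \<Rightarrow> 'm tvec \<Rightarrow> real"
    and D :: "'m connection"
  assumes "smooth_atlas A"
    and "h \<in> tensor_fields02 A"
    and "nondegenerate A h"
    and "affine_connection A D"
  shows "(nabla_integrable A D (J_c A h) \<longleftrightarrow> quasi_statistical A h D) \<and>
         (nabla_integrable A D (J_p A h) \<longleftrightarrow> quasi_statistical A h D)"
proof -
  interpret metric_connection A h D
    using assms by unfold_locales
  show ?thesis
    unfolding J_c_eq J_p_eq by (simp add: nabla_integrable_J_iff)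
qed

end
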